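(* The symmetric synthesis problem for architecture S0 is undecidable: there is no algorithm that, given an LTL formula $\varphi$ over the propositions $\{x,y,z\}$, decides whether there exists a finite-state Moore machine with input proposition set $\{a\}$ and output proposition set $\{b\}$ such that the system obtained by plugging it into both processes of S0 satisfies $\varphi$.
   Context: A symmetric architecture over a process interface $(\mathsf{AP}^I,\mathsf{AP}^O)$ consists of internal signals $S$, processes $P$, global inputs $\mathsf{AP}^I_G$, an input edge function $E^{in}:P\times\mathsf{AP}^I\to S\cup\mathsf{AP}^I_G$ and an output edge function $E^{out}:P\times\mathsf{AP}^O\to S$; every internal signal is written by exactly one process output. Plugging a Moore machine $(Q,2^{\mathsf{AP}^I},2^{\mathsf{AP}^O},\delta,q_0,L)$ into all processes yields the synchronous composition with states $P\to Q$, initial state $p\mapsto q_0$; in a state $f$ the signal $s$ is true iff $s=E^{out}(p,o)$ for some $o\in L(f(p))$; on global input $X\subseteq\mathsf{AP}^I_G$ each process $p$ moves to $\delta(f(p),\{i\in\mathsf{AP}^I\mid E^{in}(p,i)\in X\cup(\text{current true signals})\})$. The system satisfies $\varphi$ if for every infinite global input sequence, the trace whose $k$-th letter is the $k$-th global input together with the signals true in the $k$-th state satisfies $\varphi$. Architecture S0: interface $(\{a\},\{b\})$, processes $\{0,1\}$, global inputs $\{x\}$, internal signals $\{y,z\}$, $E^{in}(0,a)=x$, $E^{in}(1,a)=y$, $E^{out}(0,b)=y$, $E^{out}(1,b)=z$. *)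

theory Defs
  imports Main "HOL-Library.Nat_Bijection"
begin

datatype 'v ltl =
    LProp 'v
  | LNot "'v ltl"
  | LAnd "'v ltl" "'v ltl"
  | LNext "'v ltl"
  | LUntil "'v ltl" "'v ltl"

fun ltl_holds :: "(nat \<Rightarrow> 'v set) \<Rightarrow> nat \<Rightarrow> 'v ltl \<Rightarrow> bool" where
  "ltl_holds w i (LProp p) = (p \<in> w i)"
| "ltl_holds w i (LNot \<phi>) = (\<not> ltl_holds w i \<phi>)"
| "ltl_holds w i (LAnd \<phi> \<psi>) = (ltl_holds w i \<phi> \<and> ltl_holds w i \<psi>)"
| "ltl_holds w i (LNext \<phi>) = ltl_holds w (Suc i) \<phi>"
| "ltl_holds w i (LUntil \<phi> \<psi>) =
     (\<exists>j\<ge>i. ltl_holds w j \<psi> \<and> (\<forall>k. i \<le> k \<and> k < j \<longrightarrow> ltl_holds w k \<phi>))"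

definition ltl_sat :: "(nat \<Rightarrow> 'v set) \<Rightarrow> 'v ltl \<Rightarrow> bool" where
  "ltl_sat w \<phi> = ltl_holds w 0 \<phi>"

record ('q, 'i, 'o) moore =
  delta :: "'q \<Rightarrow> 'i set \<Rightarrow> 'q"
  init  :: "'q"
  lab   :: "'q \<Rightarrow> 'o set"

definition finite_moore :: "('q, 'i, 'o) moore \<Rightarrow> bool" where
  "finite_moore M = (\<exists>Q. finite Q \<and> init M \<in> Q \<and> (\<forall>q\<in>Q. \<forall>I. delta M q I \<in> Q))"

record ('p, 'i, 'o, 'v) arch =
  procs :: "'p set"
  gins  :: "'v set"
  sigs  :: "'v set"
  Ein   :: "'p \<Rightarrow> 'i \<Rightarrow> 'v"
  Eout  :: "'p \<Rightarrow> 'o \<Rightarrow> 'v"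

definition true_sigs :: "('p, 'i, 'o, 'v) arch \<Rightarrow> ('q, 'i, 'o) moore \<Rightarrow> ('p \<Rightarrow> 'q) \<Rightarrow> 'v set" where
  "true_sigs A M f = {s. \<exists>p\<in>procs A. \<exists>ob\<in>lab M (f p). s = Eout A p ob}"

definition comp_step :: "('p, 'i, 'o, 'v) arch \<Rightarrow> ('q, 'i, 'o) moore \<Rightarrow> ('p \<Rightarrow> 'q) \<Rightarrow> 'v set \<Rightarrow> ('p \<Rightarrow> 'q)" where
  "comp_step A M f X = (\<lambda>p. delta M (f p) {i. Ein A p i \<in> X \<union> true_sigs A M f})"

fun comp_run :: "('p, 'i, 'o, 'v) arch \<Rightarrow> ('q, 'i, 'o) moore \<Rightarrow> (nat \<Rightarrow> 'v set) \<Rightarrow> nat \<Rightarrow> ('p \<Rightarrow> 'q)" where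
  "comp_run A M w 0 = (\<lambda>p. init M)"
| "comp_run A M w (Suc k) = comp_step A M (comp_run A M w k) (w k)"

definition comp_trace :: "('p, 'i, 'o, 'v) arch \<Rightarrow> ('q, 'i, 'o) moore \<Rightarrow> (nat \<Rightarrow> 'v set) \<Rightarrow> nat \<Rightarrow> 'v set" where
  "comp_trace A M w k = w k \<union> true_sigs A M (comp_run A M w k)"

definition sys_satisfies :: "('p, 'i, 'o, 'v) arch \<Rightarrow> ('q, 'i, 'o) moore \<Rightarrow> 'v ltl \<Rightarrow> bool" where
  "sys_satisfies A M \<phi> = (\<forall>w. (\<forall>k. w k \<subseteq> gins A) \<longrightarrow> ltl_sat (comp_trace A M w) \<phi>)"

datatype inp = PropA
datatype outp = PropB
datatype proc = Proc0 | Proc1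
datatype s0var = VarX | VarY | VarZ

definition S0 :: "(proc, inp, outp, s0var) arch" where
  "S0 = \<lparr> procs = UNIV, gins = {VarX}, sigs = {VarY, VarZ},
          Ein = (\<lambda>p i. if p = Proc0 then VarX else VarY),
          Eout = (\<lambda>p ob. if p = Proc0 then VarY else VarZ) \<rparr>"

text \<open>Symmetric realizability in S0 by a finite-state Moore machine
  (states taken from nat, which is no loss since every finite machine embeds).\<close>
definition S0_realizable :: "s0var ltl \<Rightarrow> bool" where
  "S0_realizable \<phi> = (\<exists>M :: (nat, inp, outp) moore. finite_moore M \<and> sys_satisfies S0 M \<phi>)"

datatype recf =
    RZ
  | RS
  | RId nat
  | RCn recf "recf list"
  | RPr recf recf
  | RMn recf

inductive reval :: "recf \<Rightarrow> nat list \<Rightarrow> nat \<Rightarrow> bool" where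
  zero: "reval RZ xs 0"
| succ: "reval RS [x] (Suc x)"
| proj: "i < length xs \<Longrightarrow> reval (RId i) xs (xs ! i)"
| comp: "list_all2 (\<lambda>g y. reval g xs y) gs ys \<Longrightarrow> reval f ys z \<Longrightarrow> reval (RCn f gs) xs z"
| pr0:  "reval f xs y \<Longrightarrow> reval (RPr f g) (0 # xs) y"
| prS:  "reval (RPr f g) (n # xs) y \<Longrightarrow> reval g (n # y # xs) z \<Longrightarrow> reval (RPr f g) (Suc n # xs) z"
| mn:   "reval f (n # xs) 0 \<Longrightarrow> (\<forall>m<n. \<exists>y. 0 < y \<and> reval f (m # xs) y) \<Longrightarrow> reval (RMn f) xs n"
monos list_all2_mono

definition decidable_nat_set :: "nat set \<Rightarrow> bool" where
  "decidable_nat_set D = (\<exists>f. \<forall>n. reval f [n] (if n \<in> D then 1 else 0))"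

fun enc_var :: "s0var \<Rightarrow> nat" where
  "enc_var VarX = 0" | "enc_var VarY = 1" | "enc_var VarZ = 2"

fun enc_ltl :: "s0var ltl \<Rightarrow> nat" where
  "enc_ltl (LProp v) = prod_encode (0, enc_var v)"
| "enc_ltl (LNot \<phi>) = prod_encode (1, enc_ltl \<phi>)"
| "enc_ltl (LAnd \<phi> \<psi>) = prod_encode (2, prod_encode (enc_ltl \<phi>, enc_ltl \<psi>))"
| "enc_ltl (LNext \<phi>) = prod_encode (3, enc_ltl \<phi>)"
| "enc_ltl (LUntil \<phi> \<psi>) = prod_encode (4, prod_encode (enc_ltl \<phi>, enc_ltl \<psi>))"

definition decidable_ltl_prop :: "(s0var ltl \<Rightarrow> bool) \<Rightarrow> bool" where
  "decidable_ltl_prop P = (\<exists>f. \<forall>n. \<exists>r. reval f [n] r \<and>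
       (\<forall>\<phi>. n = enc_ltl \<phi> \<longrightarrow> r = (if P \<phi> then 1 else 0)))"

end

theory Submission
  imports Defs
begin

text \<open>Both processes run the same transducer \<open>F\<close>, so a trace consists of an arbitrary stream
  \<open>x\<close> together with \<open>y = F x\<close> and \<open>z = F y\<close>. The specification makes \<open>F\<close> play a word \<open>G\<close> of cells as
  soon as it receives its first pulse, of kind \<open>K\<close> or \<open>D\<close>. A first pulse \<open>K\<close> is relayed as a \<open>D\<close> in
  the same frame, a first pulse \<open>D\<close> is dropped, and later pulses are relayed with a delay of one
  frame. After a \<open>K\<close> the plays in \<open>y\<close> and \<open>z\<close> must agree: the second process has not yet seen the
  data that it has to match, so the play cannot depend on the data fed to the first process.
  After a \<open>D\<close> that is soon followed by a further pulse, the plays must agree up to the lag. As the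
  start is delayed by more than the later pulses are, iterating the two rules pushes the later
  pulses beyond any horizon, and the play is the same word \<open>G\<close> for all late starts. If the pulse after
  a \<open>D\<close> comes \<open>L\<close> frames later, where \<open>L\<close> is the row length marked in \<open>G\<close>, then \<open>z\<close> shows \<open>G\<close> while
  \<open>y\<close> shows \<open>G\<close> shifted by \<open>L\<close>, so LTL can require that consecutive rows of \<open>G\<close> are consecutive
  configurations of a counter program.

  A program computing \<open>h\<close> thus yields a formula \<open>B\<close> such that the conjunction of \<open>B\<close> with a
  formula saying that the input is \<open>n\<close> is realizable iff \<open>h n = 0\<close>. The input formulas do not depend
  on the program. Given a decider, let \<open>h n\<close> be its answer on the code of the conjunction of the
  input formula for \<open>n\<close> with the formula whose code is \<open>n\<close>, and take for \<open>n\<close> the code of \<open>B\<close>.\<close>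

section \<open>Recursive functions\<close>

definition rcomp1 :: "(nat \<Rightarrow> nat) \<Rightarrow> bool" where
  "rcomp1 f = (\<exists>F. \<forall>x. reval F [x] (f x))"

definition rcomp2 :: "(nat \<Rightarrow> nat \<Rightarrow> nat) \<Rightarrow> bool" where
  "rcomp2 f = (\<exists>F. \<forall>x y. reval F [x, y] (f x y))"

lemma reval_const: "\<exists>F. \<forall>xs. reval F xs c"
proof (induction c)
  case 0
  show ?case using reval.zero by blast
next
  case (Suc c)
  then obtain F where F: "\<forall>xs. reval F xs c" by blast
  have "reval (RCn RS [F]) xs (Suc c)" for xs
    by (rule reval.comp[of _ _ "[c]"]) (simp_all add: F reval.succ)
  then show ?case by blast
qed

lemma reval_RId: "i < length xs \<Longrightarrow> y = xs ! i \<Longrightarrow> reval (RId i) xs y"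
  by (simp add: reval.proj)

lemma rcomp1_const: "rcomp1 (\<lambda>_. c)"
  using reval_const unfolding rcomp1_def by blast

lemma rcomp1_id: "rcomp1 (\<lambda>x. x)"
  unfolding rcomp1_def by (intro exI[of _ "RId 0"]) (simp add: reval_RId)

lemma rcomp2_fst: "rcomp2 (\<lambda>x y. x)"
  unfolding rcomp2_def by (intro exI[of _ "RId 0"]) (simp add: reval_RId)

lemma rcomp2_snd: "rcomp2 (\<lambda>x y. y)"
  unfolding rcomp2_def by (intro exI[of _ "RId 1"]) (simp add: reval_RId)

lemma rcomp1_Suc: "rcomp1 Suc"
  unfolding rcomp1_def using reval.succ by blast

lemma rcomp2_comp1:
  assumes "rcomp1 f" "rcomp2 g" shows "rcomp2 (\<lambda>x y. f (g x y))"
proof -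
  obtain F G where "\<And>x. reval F [x] (f x)" "\<And>x y. reval G [x, y] (g x y)"
    using assms unfolding rcomp1_def rcomp2_def by blast
  then have "reval (RCn F [G]) [x, y] (f (g x y))" for x y
    by (intro reval.comp[of _ _ "[g x y]"]) simp_all
  then show ?thesis unfolding rcomp2_def by blast
qed

lemma rcomp1_comp2:
  assumes "rcomp2 f" "rcomp1 g" "rcomp1 h" shows "rcomp1 (\<lambda>x. f (g x) (h x))"
proof -
  obtain F G H where "\<And>x y. reval F [x, y] (f x y)" "\<And>x. reval G [x] (g x)" "\<And>x. reval H [x] (h x)"
    using assms unfolding rcomp1_def rcomp2_def by blast
  then have "reval (RCn F [G, H]) [x] (f (g x) (h x))" for x
    by (intro reval.comp[of _ _ "[g x, h x]"]) simp_all
  then show ?thesis unfolding rcomp1_def by blast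
qed

lemma rcomp2_comp2:
  assumes "rcomp2 f" "rcomp2 g" "rcomp2 h" shows "rcomp2 (\<lambda>x y. f (g x y) (h x y))"
proof -
  obtain F G H where "\<And>x y. reval F [x, y] (f x y)" "\<And>x y. reval G [x, y] (g x y)"
    "\<And>x y. reval H [x, y] (h x y)"
    using assms unfolding rcomp2_def by blast
  then have "reval (RCn F [G, H]) [x, y] (f (g x y) (h x y))" for x y
    by (intro reval.comp[of _ _ "[g x y, h x y]"]) simp_all
  then show ?thesis unfolding rcomp2_def by blast
qed

text \<open>\<open>RPr\<close> hands its step function the counter before the accumulator, which is
  also the argument order of \<open>rec_nat\<close>; without parameters the two recursions
  coincide.\<close>

lemma rcomp1_rec_nat:
  assumes "rcomp2 g" shows "rcomp1 (rec_nat a g)"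
proof -
  obtain A G where A: "\<And>xs. reval A xs a" and G: "\<And>x y. reval G [x, y] (g x y)"
    using assms reval_const[of a] unfolding rcomp2_def by blast
  have "reval (RPr A G) [n] (rec_nat a g n)" for n
    by (induction n) (auto intro: reval.pr0 reval.prS A G)
  then show ?thesis unfolding rcomp1_def by blast
qed

lemma rcomp2_add: "rcomp2 (+)"
proof -
  have "reval (RPr (RId 0) (RCn RS [RId 1])) [x, y] (x + y)" for x y
  proof (induction x)
    case 0
    show ?case by (rule reval.pr0) (simp add: reval_RId)
  next
    case (Suc x)
    have "reval (RCn RS [RId 1]) [x, x + y, y] (Suc (x + y))"
      by (rule reval.comp[of _ _ "[x + y]"]) (simp_all add: reval_RId reval.succ)
    then show ?case using reval.prS[OF Suc] by simp
  qed
  then show ?thesis unfolding rcomp2_def by blast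
qed

lemma rcomp1_triangle: "rcomp1 triangle"
proof -
  have "rcomp1 (rec_nat 0 (\<lambda>n y. y + Suc n))"
    by (intro rcomp1_rec_nat rcomp2_comp2[OF rcomp2_add] rcomp2_snd rcomp2_comp1[OF rcomp1_Suc] rcomp2_fst)
  moreover have "rec_nat 0 (\<lambda>n y. y + Suc n) = triangle"
  proof
    show "rec_nat 0 (\<lambda>n y. y + Suc n) n = triangle n" for n
      by (induction n) simp_all
  qed
  ultimately show ?thesis by simp
qed

lemma rcomp2_prod_encode: "rcomp2 (\<lambda>m n. prod_encode (m, n))"
proof -
  have "rcomp2 (\<lambda>m n. triangle (m + n) + m)"
    by (intro rcomp2_comp2[OF rcomp2_add] rcomp2_comp1[OF rcomp1_triangle] rcomp2_add rcomp2_fst)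
  then show ?thesis by (simp add: prod_encode_def)
qed

section \<open>Counter programs\<close>

datatype cmd = Inc nat | Dec nat | Seq cmd cmd | Loop nat cmd

fun step :: "cmd list \<times> (nat \<Rightarrow> nat) \<Rightarrow> cmd list \<times> (nat \<Rightarrow> nat)" where
  "step ([], s) = ([], s)"
| "step (Inc r # cs, s) = (cs, s(r := Suc (s r)))"
| "step (Dec r # cs, s) = (cs, s(r := s r - 1))"
| "step (Seq a b # cs, s) = (a # b # cs, s)"
| "step (Loop r c # cs, s) = (if s r = 0 then cs else c # Loop r c # cs, s)"

text \<open>The continuation \<open>cs\<close> is quantified so that a run can be replayed on top of
  any stack of pending commands; this makes runs compose in \<open>run_Seq\<close> and
  \<open>run_LoopS\<close>.\<close>

definition run :: "cmd \<Rightarrow> (nat \<Rightarrow> nat) \<Rightarrow> (nat \<Rightarrow> nat) \<Rightarrow> bool" where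
  "run c s s' = (\<forall>cs. \<exists>k. (step ^^ k) (c # cs, s) = (cs, s'))"

lemma step_trans:
  assumes "\<exists>k. (step ^^ k) a = b" "\<exists>k. (step ^^ k) b = c"
  shows "\<exists>k. (step ^^ k) a = c"
proof -
  obtain k l where "(step ^^ k) a = b" "(step ^^ l) b = c" using assms by blast
  then have "(step ^^ (l + k)) a = c" by (simp add: funpow_add)
  then show ?thesis by blast
qed

lemma step_first:
  assumes "\<exists>k. (step ^^ k) (step a) = c" shows "\<exists>k. (step ^^ k) a = c"
  using assms by (metis funpow_Suc_right o_apply)

lemma run_Inc: "s' = s(r := Suc (s r)) \<Longrightarrow> run (Inc r) s s'"
  unfolding run_def by (intro allI exI[of _ 1]) simp

lemma run_Dec: "s' = s(r := s r - 1) \<Longrightarrow> run (Dec r) s s'"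
  unfolding run_def by (intro allI exI[of _ 1]) simp

lemma run_Seq: "run a s s' \<Longrightarrow> run b s' s'' \<Longrightarrow> run (Seq a b) s s''"
  unfolding run_def by (intro allI, rule step_first) (use step_trans in simp, blast)

lemma run_Loop0: "s r = 0 \<Longrightarrow> run (Loop r c) s s"
  unfolding run_def by (intro allI exI[of _ 1]) simp

lemma run_LoopS: "s r \<noteq> 0 \<Longrightarrow> run c s s' \<Longrightarrow> run (Loop r c) s' s'' \<Longrightarrow> run (Loop r c) s s''"
  unfolding run_def by (intro allI, rule step_first) (use step_trans in simp, blast)

section \<open>Clearing, moving and copying registers\<close>

definition clear :: "nat \<Rightarrow> cmd" where "clear r = Loop r (Dec r)"

lemma run_clear: "s' = s(r := 0) \<Longrightarrow> run (clear r) s s'"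
  unfolding clear_def
proof (induction "s r" arbitrary: s)
  case 0
  then show ?case by (simp add: run_Loop0 fun_upd_idem)
next
  case (Suc n)
  have sr: "s r = Suc n" using Suc(2) by simp
  have "run (Dec r) s (s(r := n))" by (rule run_Dec) (simp add: sr)
  moreover have "run (Loop r (Dec r)) (s(r := n)) s'"
    by (rule Suc(1)) (simp_all add: Suc(3))
  ultimately show ?case using sr by (auto intro: run_LoopS)
qed

definition move :: "nat \<Rightarrow> nat \<Rightarrow> cmd" where "move a d = Loop a (Seq (Dec a) (Inc d))"

lemma run_move: "a \<noteq> d \<Longrightarrow> s' = s(a := 0, d := s d + s a) \<Longrightarrow> run (move a d) s s'"
  unfolding move_def
proof (induction "s a" arbitrary: s)
  case 0
  then show ?case by (simp add: run_Loop0 fun_upd_idem)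
next
  case (Suc n)
  have sa: "s a = Suc n" using Suc(2) by simp
  have "run (Dec a) s (s(a := n))" by (rule run_Dec) (simp add: sa)
  moreover have "run (Inc d) (s(a := n)) (s(a := n, d := Suc (s d)))"
    using Suc(3) by (intro run_Inc) simp
  moreover have "run (Loop a (Seq (Dec a) (Inc d))) (s(a := n, d := Suc (s d))) s'"
    using Suc(3,4) sa by (intro Suc(1)) (auto simp: fun_eq_iff)
  ultimately show ?case using sa by (auto intro: run_LoopS run_Seq)
qed

definition copy :: "nat \<Rightarrow> nat \<Rightarrow> nat \<Rightarrow> cmd" where
  "copy a d t = Seq (Loop a (Seq (Dec a) (Seq (Inc d) (Inc t)))) (move t a)"

lemma run_copy:
  assumes "a \<noteq> d" "a \<noteq> t" "d \<noteq> t" "s t = 0" "s' = s(d := s d + s a)"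
  shows "run (copy a d t) s s'"
proof -
  \<comment> \<open>The loop drains \<open>a\<close> into \<open>d\<close> and \<open>t\<close>
    together, and the final \<open>move\<close> refills \<open>a\<close>. The contents of
    \<open>t\<close> are arbitrary here because they grow during the induction.\<close>
  have "run (Loop a (Seq (Dec a) (Seq (Inc d) (Inc t)))) s (s(a := 0, d := s d + s a, t := s t + s a))" for s
    using assms(1-3)
  proof (induction "s a" arbitrary: s)
    case 0
    then show ?case by (simp add: run_Loop0 fun_upd_idem)
  next
    case (Suc n)
    let ?u = "s(a := n, d := Suc (s d), t := Suc (s t))"
    have sa: "s a = Suc n" using Suc(2) by simp
    have "run (Dec a) s (s(a := n))" by (rule run_Dec) (simp add: sa)
    moreover have "run (Inc d) (s(a := n)) (s(a := n, d := Suc (s d)))"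
      using Suc(3) by (intro run_Inc) simp
    moreover have "run (Inc t) (s(a := n, d := Suc (s d))) ?u"
      using Suc(4,5) by (intro run_Inc) simp
    moreover have "run (Loop a (Seq (Dec a) (Seq (Inc d) (Inc t)))) ?u
        (?u(a := 0, d := ?u d + ?u a, t := ?u t + ?u a))"
      using Suc(3-5) by (intro Suc(1)) auto
    moreover have "?u(a := 0, d := ?u d + ?u a, t := ?u t + ?u a) = s(a := 0, d := s d + s a, t := s t + s a)"
      using Suc(3-5) sa by (auto simp: fun_eq_iff)
    ultimately show ?case using sa by (metis run_LoopS run_Seq nat.distinct(1))
  qed
  then show ?thesis unfolding copy_def
    by (rule run_Seq) (use assms in \<open>auto intro!: run_move simp: fun_eq_iff\<close>)
qed

text \<open>Calling convention: arguments and destination lie below \<open>b\<close>; the registers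
  from \<open>b\<close> on are scratch space, zero before and, since only \<open>d\<close> changes,
  zero again afterwards. As \<open>b\<close> is arbitrary, a caller can place the scratch space of a
  subprogram above its own.\<close>

definition compiles :: "recf \<Rightarrow> bool" where
  "compiles F = (\<forall>as d b. (\<forall>a\<in>set as. a < b) \<and> d < b \<and> d \<notin> set as \<longrightarrow>
     (\<exists>c. \<forall>s y. (\<forall>r\<ge>b. s r = 0) \<longrightarrow> s d = 0 \<longrightarrow> reval F (map s as) y \<longrightarrow> run c s (s(d := y))))"

lemma compilesI:
  assumes "\<And>as d b. \<forall>a\<in>set as. a < b \<Longrightarrow> d < b \<Longrightarrow> d \<notin> set as \<Longrightarrow>
     \<exists>c. \<forall>s y. (\<forall>r\<ge>b. s r = 0) \<longrightarrow> s d = 0 \<longrightarrow> reval F (map s as) y \<longrightarrow> run c s (s(d := y))"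
  shows "compiles F"
  unfolding compiles_def by (intro allI impI, elim conjE, rule assms)

lemma compilesE:
  assumes "compiles F" "\<forall>a\<in>set as. a < b" "d < b" "d \<notin> set as"
  obtains c where "\<And>s y xs. \<forall>r\<ge>b. s r = 0 \<Longrightarrow> s d = 0 \<Longrightarrow> reval F xs y \<Longrightarrow> map s as = xs \<Longrightarrow> run c s (s(d := y))"
proof -
  from assms obtain c where "\<forall>s y. (\<forall>r\<ge>b. s r = 0) \<longrightarrow> s d = 0 \<longrightarrow> reval F (map s as) y \<longrightarrow> run c s (s(d := y))"
    unfolding compiles_def by (elim allE[of _ as] allE[of _ d] allE[of _ b]) auto
  then show ?thesis by (intro that[of c]) blast
qed

section \<open>Compilation, constructor by constructor\<close>

inductive_cases reval_RZ: "reval RZ xs y"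
inductive_cases reval_RS: "reval RS xs y"
inductive_cases reval_RIdE: "reval (RId i) xs y"
inductive_cases reval_RCn: "reval (RCn f gs) xs y"
inductive_cases reval_RPr0: "reval (RPr f g) (0 # xs) y"
inductive_cases reval_RPrS: "reval (RPr f g) (Suc n # xs) y"
inductive_cases reval_RPr: "reval (RPr f g) xs y"
inductive_cases reval_RMn: "reval (RMn f) xs y"

lemma compiles_RZ: "compiles RZ"
proof (rule compilesI)
  fix as and d b :: nat
  show "\<exists>c. \<forall>s y. (\<forall>r\<ge>b. s r = 0) \<longrightarrow> s d = 0 \<longrightarrow> reval RZ (map s as) y \<longrightarrow> run c s (s(d := y))"
    by (intro exI[of _ "Dec d"]) (auto elim!: reval_RZ intro: run_Dec)
qed

lemma compiles_RS: "compiles RS"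
proof (rule compilesI)
  fix as and d b :: nat
  assume h: "\<forall>a\<in>set as. a < b" "d < b" "d \<notin> set as"
  have "run (Seq (copy (hd as) d b) (Inc d)) s (s(d := y))"
    if "\<forall>r\<ge>b. s r = 0" "s d = 0" "reval RS (map s as) y" for s y
  proof -
    from that(3) obtain a where "as = [a]" "y = Suc (s a)" by (auto elim: reval_RS)
    then show ?thesis
      using h that by (intro run_Seq[of _ _ "s(d := s a)"] run_copy run_Inc) auto
  qed
  then show "\<exists>c. \<forall>s y. (\<forall>r\<ge>b. s r = 0) \<longrightarrow> s d = 0 \<longrightarrow> reval RS (map s as) y \<longrightarrow> run c s (s(d := y))"
    by blast
qed

lemma compiles_RId: "compiles (RId i)"
proof (rule compilesI)
  fix as and d b :: nat
  assume h: "\<forall>a\<in>set as. a < b" "d < b" "d \<notin> set as"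
  have "run (copy (as ! i) d b) s (s(d := y))"
    if "\<forall>r\<ge>b. s r = 0" "s d = 0" "reval (RId i) (map s as) y" for s y
  proof -
    have "i < length as" "y = s (as ! i)" using that(3) by (auto elim: reval_RIdE)
    then have "as ! i < b" "as ! i \<noteq> d" using h by (metis nth_mem)+
    then show ?thesis
      using h that \<open>y = _\<close> by (intro run_copy) auto
  qed
  then show "\<exists>c. \<forall>s y. (\<forall>r\<ge>b. s r = 0) \<longrightarrow> s d = 0 \<longrightarrow> reval (RId i) (map s as) y \<longrightarrow> run c s (s(d := y))"
    by blast
qed

definition put :: "(nat \<Rightarrow> nat) \<Rightarrow> nat \<Rightarrow> nat list \<Rightarrow> nat \<Rightarrow> nat" where
  "put s b ys = (\<lambda>r. if b \<le> r \<and> r < b + length ys then ys ! (r - b) else s r)"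

lemma put_Nil: "put s b [] = s"
  by (auto simp: put_def)

lemma put_snoc: "put s b (ys @ [y]) = (put s b ys)(b + length ys := y)"
  by (auto simp: put_def fun_eq_iff nth_append)

text \<open>All subprograms take their scratch space from the common bound \<open>b'\<close> on,
  which stays fixed in the induction and lies beyond every result register, so no call disturbs an
  earlier result.\<close>

lemma compile_args:
  assumes "\<forall>g\<in>set gs. compiles g" "\<forall>a\<in>set as. a < b" "b + length gs \<le> b'"
  shows "\<exists>c. \<forall>s ys. (\<forall>r\<ge>b. s r = 0) \<longrightarrow> list_all2 (\<lambda>g y. reval g (map s as) y) gs ys \<longrightarrow>
    run c s (put s b ys)"
  using assms(1,3)
proof (induction gs rule: rev_induct)
  case Nil
  have "run (Dec b) s s" if "\<forall>r\<ge>b. s r = (0 :: nat)" for s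
    using that by (intro run_Dec) auto
  then show ?case by (auto simp: put_Nil)
next
  case (snoc g gs)
  obtain c where c: "\<And>s ys. \<forall>r\<ge>b. s r = 0 \<Longrightarrow> list_all2 (\<lambda>g y. reval g (map s as) y) gs ys \<Longrightarrow>
    run c s (put s b ys)" using snoc by auto
  have "compiles g" using snoc by auto
  then obtain e where e: "\<And>s y xs. \<forall>r\<ge>b'. s r = 0 \<Longrightarrow> s (b + length gs) = 0 \<Longrightarrow>
      reval g xs y \<Longrightarrow> map s as = xs \<Longrightarrow> run e s (s(b + length gs := y))"
    by (rule compilesE[of g as b' "b + length gs"]) (use assms(2) snoc(3) in auto)
  have "run (Seq c e) s (put s b ys)"
    if s: "\<forall>r\<ge>b. s r = 0" and l: "list_all2 (\<lambda>g y. reval g (map s as) y) (gs @ [g]) ys" for s ys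
  proof -
    obtain zs y where ys: "ys = zs @ [y]" and zs: "list_all2 (\<lambda>g y. reval g (map s as) y) gs zs"
      and y: "reval g (map s as) y"
      using l by (auto simp: list_all2_append1 list_all2_Cons1)
    have len: "length zs = length gs" using zs by (simp add: list_all2_lengthD)
    have "run e (put s b zs) ((put s b zs)(b + length gs := y))"
      by (rule e[OF _ _ y]) (use s assms(2) snoc(3) len in \<open>auto simp: put_def\<close>)
    then show ?thesis using c[OF s zs] by (auto simp: ys put_snoc len intro: run_Seq)
  qed
  then show ?case by blast
qed

lemma compile_clears:
  "\<exists>c. \<forall>s s'. s' = (\<lambda>r. if b \<le> r \<and> r < b + n then 0 else s r) \<longrightarrow> run c s s'"
proof (induction n)
  case 0
  \<comment> \<open>No register is known to be zero here, so the empty program is an increment that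
    is undone.\<close>
  have "run (Seq (Inc 0) (Dec 0)) s s" for s
    by (rule run_Seq[of _ _ "s(0 := Suc (s 0))"]) (auto intro: run_Inc run_Dec)
  moreover have "(\<lambda>r. if b \<le> r \<and> r < b + 0 then 0 else s r) = s" for s :: "nat \<Rightarrow> nat"
    by auto
  ultimately show ?case by (intro exI[of _ "Seq (Inc 0) (Dec 0)"]) simp
next
  case (Suc n)
  then obtain c where c: "\<And>s. run c s (\<lambda>r. if b \<le> r \<and> r < b + n then 0 else s r)" by blast
  have "run (Seq c (clear (b + n))) s (\<lambda>r. if b \<le> r \<and> r < b + Suc n then 0 else s r)" for s
    by (rule run_Seq[OF c]) (auto intro!: run_clear)
  then show ?case by blast
qed

lemma compiles_RCn:
  assumes "compiles f" "\<forall>g\<in>set gs. compiles g"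
  shows "compiles (RCn f gs)"
proof (rule compilesI)
  fix as and d b :: nat
  assume h: "\<forall>a\<in>set as. a < b" "d < b" "d \<notin> set as"
  let ?n = "length gs"
  obtain c1 where c1: "\<And>s ys. \<forall>r\<ge>b. s r = 0 \<Longrightarrow>
      list_all2 (\<lambda>g y. reval g (map s as) y) gs ys \<Longrightarrow> run c1 s (put s b ys)"
    using compile_args[OF assms(2) h(1) order_refl] by auto
  obtain c2 where c2: "\<And>s y xs. \<forall>r\<ge>b + ?n. s r = 0 \<Longrightarrow> s d = 0 \<Longrightarrow> reval f xs y \<Longrightarrow>
      map s [b..<b + ?n] = xs \<Longrightarrow> run c2 s (s(d := y))"
    by (rule compilesE[OF assms(1), of "[b..<b + ?n]" "b + ?n" d]) (use h in auto)
  obtain c3 where c3: "\<And>s s'. s' = (\<lambda>r. if b \<le> r \<and> r < b + ?n then 0 else s r) \<Longrightarrow> run c3 s s'"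
    using compile_clears[of b ?n] by blast
  have "run (Seq c1 (Seq c2 c3)) s (s(d := y))"
    if s: "\<forall>r\<ge>b. s r = 0" "s d = 0" and y: "reval (RCn f gs) (map s as) y" for s y
  proof -
    obtain ys where ys: "list_all2 (\<lambda>g y. reval g (map s as) y) gs ys" and f: "reval f ys y"
      using y by (auto elim: reval_RCn)
    have len: "length ys = ?n" using ys by (simp add: list_all2_lengthD)
    have "map (put s b ys) [b..<b + ?n] = ys"
      by (rule nth_equalityI) (auto simp: len put_def)
    then have "run c2 (put s b ys) ((put s b ys)(d := y))"
      using s h len by (intro c2[OF _ _ f]) (auto simp: put_def)
    moreover have "run c3 ((put s b ys)(d := y)) (s(d := y))"
      using s h len by (intro c3) (auto simp: put_def)
    ultimately show ?thesis using c1[OF s(1) ys] by (blast intro: run_Seq)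
  qed
  then show "\<exists>c. \<forall>s y. (\<forall>r\<ge>b. s r = 0) \<longrightarrow> s d = 0 \<longrightarrow> reval (RCn f gs) (map s as) y \<longrightarrow>
      run c s (s(d := y))" by blast
qed

text \<open>One derivation is unrolled into its intermediate values, without appeal to determinism
  of \<open>reval\<close>; \<open>v i\<close> is the accumulator after \<open>i\<close> rounds of
  the compiled loop.\<close>

lemma reval_RPr_values:
  assumes "reval (RPr f g) (n # xs) y"
  shows "\<exists>v. v n = y \<and> reval f xs (v 0) \<and> (\<forall>i<n. reval g (i # v i # xs) (v (Suc i)))"
  using assms
proof (induction n arbitrary: y)
  case 0
  then show ?case by (auto elim!: reval_RPr0)
next
  case (Suc n)
  from Suc.prems obtain y' where y': "reval (RPr f g) (n # xs) y'" "reval g (n # y' # xs) y"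
    by (auto elim: reval_RPrS)
  from Suc.IH[OF y'(1)] obtain v where
    v: "v n = y'" "reval f xs (v 0)" "\<forall>i<n. reval g (i # v i # xs) (v (Suc i))" by blast
  show ?case
    by (rule exI[of _ "v(Suc n := y)"]) (use v y'(2) in \<open>auto simp: less_Suc_eq\<close>)
qed

text \<open>Layout of the scratch registers: \<open>b\<close> holds the accumulator, \<open>b + 1\<close> the recursion
  counter, \<open>b + 2\<close> the number of remaining rounds and \<open>b + 3\<close> the new accumulator.\<close>

lemma compiles_RPr:
  assumes "compiles f" "compiles g"
  shows "compiles (RPr f g)"
proof (rule compilesI)
  fix as and d b :: nat
  assume h: "\<forall>a\<in>set as. a < b" "d < b" "d \<notin> set as"
  let ?as = "tl as"
  have h': "\<forall>a\<in>set ?as. a < b" "d \<notin> set ?as"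
    using h by (cases as; simp)+
  obtain cf where cf: "\<And>s y xs. \<forall>r\<ge>b + 4. s r = 0 \<Longrightarrow> s b = 0 \<Longrightarrow> reval f xs y \<Longrightarrow>
      map s ?as = xs \<Longrightarrow> run cf s (s(b := y))"
    by (rule compilesE[OF assms(1), of ?as "b + 4" b]) (use h' in \<open>auto simp: less_imp_not_eq less_SucI trans_less_add1\<close>)
  obtain cg where cg: "\<And>s y xs. \<forall>r\<ge>b + 4. s r = 0 \<Longrightarrow> s (b + 3) = 0 \<Longrightarrow> reval g xs y \<Longrightarrow>
      map s ((b + 1) # b # ?as) = xs \<Longrightarrow> run cg s (s(b + 3 := y))"
    by (rule compilesE[OF assms(2), of "(b + 1) # b # ?as" "b + 4" "b + 3"]) (use h' in \<open>auto simp: trans_less_add1\<close>)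
  let ?body = "Seq cg (Seq (clear b) (Seq (move (b + 3) b) (Seq (Inc (b + 1)) (Dec (b + 2)))))"
  let ?c = "Seq cf (Seq (copy (hd as) (b + 2) (b + 3)) (Seq (Loop (b + 2) ?body)
    (Seq (move b d) (clear (b + 1)))))"
  have "run ?c s (s(d := y))"
    if s: "\<forall>r\<ge>b. s r = 0" "s d = 0" and y: "reval (RPr f g) (map s as) y" for s y
  proof -
    obtain n xs where nx: "map s as = n # xs" using y by (auto elim: reval_RPr)
    then have as: "as = hd as # ?as" "s (hd as) = n" "map s ?as = xs" by auto
    have hd: "hd as < b" using h as(1) by (metis list.set_intros(1))
    obtain v where v: "v n = y" "reval f xs (v 0)"
      and vS: "\<And>i. i < n \<Longrightarrow> reval g (i # v i # xs) (v (Suc i))"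
      using reval_RPr_values y nx by metis
    let ?t = "\<lambda>i. s(b := v i, b + 1 := i, b + 2 := n - i)"
    have xs: "map (s(b := p, b + 1 := q, b + 2 := r)) ?as = xs" for p q r
      using as(3) h'(1) by (auto intro!: map_cong)
    have body: "run ?body (?t i) (?t (Suc i))" if i: "i < n" for i
    proof -
      have "run cg (?t i) ((?t i)(b + 3 := v (Suc i)))"
        by (rule cg[OF _ _ vS[OF i]]) (use s xs in auto)
      moreover have "run (clear b) ((?t i)(b + 3 := v (Suc i))) ((?t i)(b + 3 := v (Suc i), b := 0))"
        by (rule run_clear) simp
      moreover have "run (move (b + 3) b) ((?t i)(b + 3 := v (Suc i), b := 0)) ((?t i)(b := v (Suc i)))"
        using s by (intro run_move) (auto simp: fun_eq_iff)
      moreover have "run (Inc (b + 1)) ((?t i)(b := v (Suc i))) ((?t i)(b := v (Suc i), b + 1 := Suc i))"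
        by (rule run_Inc) (auto simp: fun_eq_iff)
      moreover have "run (Dec (b + 2)) ((?t i)(b := v (Suc i), b + 1 := Suc i)) (?t (Suc i))"
        by (rule run_Dec) (auto simp: fun_eq_iff)
      ultimately show ?thesis by (blast intro: run_Seq)
    qed
    have loop: "run (Loop (b + 2) ?body) (?t i) (?t n)" if "i \<le> n" for i
      using that
    proof (induction i rule: inc_induct)
      case base
      show ?case by (rule run_Loop0) simp
    next
      case (step i)
      show ?case by (rule run_LoopS[OF _ body step(3)]) (use step in auto)
    qed
    have "run cf s (s(b := v 0))" by (rule cf[OF _ _ v(2)]) (use s as in auto)
    moreover have "run (copy (hd as) (b + 2) (b + 3)) (s(b := v 0)) (?t 0)"
      using s hd as by (intro run_copy) (auto simp: fun_eq_iff)
    moreover have "run (move b d) (?t n) (s(d := y, b + 1 := n))"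
      using s h v by (intro run_move) (auto simp: fun_eq_iff)
    moreover have "run (clear (b + 1)) (s(d := y, b + 1 := n)) (s(d := y))"
      using s h by (intro run_clear) (auto simp: fun_eq_iff)
    ultimately show ?thesis using loop[of 0] by (blast intro: run_Seq)
  qed
  then show "\<exists>c. \<forall>s y. (\<forall>r\<ge>b. s r = 0) \<longrightarrow> s d = 0 \<longrightarrow> reval (RPr f g) (map s as) y \<longrightarrow>
      run c s (s(d := y))" by blast
qed

text \<open>The destination \<open>d\<close> doubles as search counter and first argument of
  \<open>f\<close>, and \<open>b\<close> holds the latest value of \<open>f\<close>; when
  \<open>b\<close> reaches zero the result is already in place.\<close>

lemma compiles_RMn:
  assumes "compiles f"
  shows "compiles (RMn f)"
proof (rule compilesI)
  fix as and d b :: nat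
  assume h: "\<forall>a\<in>set as. a < b" "d < b" "d \<notin> set as"
  obtain cf where cf: "\<And>s y xs. \<forall>r\<ge>b + 1. s r = 0 \<Longrightarrow> s b = 0 \<Longrightarrow> reval f xs y \<Longrightarrow>
      map s (d # as) = xs \<Longrightarrow> run cf s (s(b := y))"
    by (rule compilesE[OF assms(1), of "d # as" "b + 1" b]) (use h in \<open>auto simp: less_SucI\<close>)
  let ?body = "Seq (clear b) (Seq (Inc d) cf)"
  have "run (Seq cf (Loop b ?body)) s (s(d := y))"
    if s: "\<forall>r\<ge>b. s r = 0" "s d = 0" and y: "reval (RMn f) (map s as) y" for s y
  proof -
    obtain v where v0: "\<And>m. m < y \<Longrightarrow> 0 < v m" and v: "v y = 0" "\<And>m. m \<le> y \<Longrightarrow> reval f (m # map s as) (v m)"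
    proof -
      have "reval f (y # map s as) 0" "\<forall>m. \<exists>z. m < y \<longrightarrow> 0 < z \<and> reval f (m # map s as) z"
        using y by (auto elim: reval_RMn)
      then have "\<exists>u. \<forall>m. m < y \<longrightarrow> 0 < u m \<and> reval f (m # map s as) (u m)" by (intro choice)
      then obtain u where u: "\<forall>m. m < y \<longrightarrow> 0 < u m \<and> reval f (m # map s as) (u m)" ..
      show ?thesis
      proof (rule that)
        show "0 < (u(y := 0)) m" if "m < y" for m using u that by simp
        show "(u(y := 0)) y = 0" by simp
        show "reval f (m # map s as) ((u(y := 0)) m)" if "m \<le> y" for m
          using u that \<open>reval f (y # map s as) 0\<close> by (cases "m = y") auto
      qed
    qed
    let ?t = "\<lambda>i. s(d := i, b := v i)"
    have as: "map (s(d := i)) as = map s as" for i using h by (auto intro!: map_cong)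
    have cf': "run cf (s(d := i)) (?t i)" if "i \<le> y" for i
      by (rule cf[OF _ _ v(2)[OF that]]) (use s h as in auto)
    have loop: "run (Loop b ?body) (?t i) (?t y)" if "i \<le> y" for i
      using that
    proof (induction i rule: inc_induct)
      case base
      show ?case by (rule run_Loop0) (use v in auto)
    next
      case (step i)
      have "run (clear b) (?t i) (s(d := i))" using s h by (intro run_clear) (auto simp: fun_eq_iff)
      moreover have "run (Inc d) (s(d := i)) (s(d := Suc i))" by (rule run_Inc) auto
      ultimately have "run ?body (?t i) (?t (Suc i))"
        using cf'[of "Suc i"] step by (auto intro: run_Seq)
      moreover have "?t i b \<noteq> 0" using v0[of i] step by simp
      ultimately show ?case using step(3) by (blast intro: run_LoopS)
    qed
    have "run cf s (?t 0)" using cf'[of 0] s by (simp add: fun_upd_idem)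
    moreover have "?t y = s(d := y)" using v s h by (auto simp: fun_eq_iff)
    ultimately show ?thesis using loop[of 0] by (auto intro: run_Seq)
  qed
  then show "\<exists>c. \<forall>s y. (\<forall>r\<ge>b. s r = 0) \<longrightarrow> s d = 0 \<longrightarrow> reval (RMn f) (map s as) y \<longrightarrow>
      run c s (s(d := y))" by blast
qed

lemma compiles_all: "compiles F"
  by (induction F) (auto intro: compiles_RZ compiles_RS compiles_RId compiles_RCn compiles_RPr compiles_RMn)

lemma compile_unary:
  assumes "\<And>n. reval F [n] (h n)"
  obtains c where "\<And>n. run c ((\<lambda>_. 0)(0 := n)) ((\<lambda>_. 0)(0 := n, 1 := h n))"
proof -
  obtain c where c: "\<And>s y xs. \<forall>r\<ge>2. s r = 0 \<Longrightarrow> s 1 = 0 \<Longrightarrow> reval F xs y \<Longrightarrow>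
      map s [0] = xs \<Longrightarrow> run c s (s(1 := y))"
    by (rule compilesE[OF compiles_all[of F], of "[0]" 2 1]) auto
  have "run c ((\<lambda>_. 0)(0 := n)) ((\<lambda>_. 0)(0 := n, 1 := h n))" for n
    by (rule c[OF _ _ assms]) auto
  then show ?thesis by (rule that)
qed

section \<open>LTL-definable properties of streams\<close>

type_synonym stream = "nat \<Rightarrow> bool"

definition tracks :: "(nat \<Rightarrow> s0var set) \<Rightarrow> s0var \<Rightarrow> stream" where
  "tracks w v = (\<lambda>j. v \<in> w j)"

text \<open>LTL properties are handled semantically, as predicates on the three streams and a
  position; closure lemmas then yield a formula for the specification without writing it
  out.\<close>

definition definable :: "(stream \<Rightarrow> stream \<Rightarrow> stream \<Rightarrow> nat \<Rightarrow> bool) \<Rightarrow> bool" where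
  "definable P = (\<exists>\<phi>. \<forall>w i. ltl_holds w i \<phi> = P (tracks w VarX) (tracks w VarY) (tracks w VarZ) i)"

lemma definableI:
  assumes "\<And>w i. ltl_holds w i \<phi> = P (tracks w VarX) (tracks w VarY) (tracks w VarZ) i"
  shows "definable P"
  using assms unfolding definable_def by blast

lemma definable_shift:
  assumes "definable P" shows "definable (\<lambda>x y z i. P x y z (i + n))"
proof (induction n)
  case 0
  show ?case using assms by simp
next
  case (Suc n)
  then obtain \<phi> where
    "\<And>w i. ltl_holds w i \<phi> = P (tracks w VarX) (tracks w VarY) (tracks w VarZ) (i + n)"
    unfolding definable_def by blast
  then show ?case unfolding definable_def by (intro exI[of _ "LNext \<phi>"]) simp
qed

lemma definable_at0: "definable (\<lambda>x y z i. x i)" "definable (\<lambda>x y z i. y i)" "definable (\<lambda>x y z i. z i)"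
  by (auto intro: definableI[of "LProp VarX"] definableI[of "LProp VarY"] definableI[of "LProp VarZ"]
      simp: tracks_def)

lemmas definable_at = definable_at0 definable_at0[THEN definable_shift]

lemma definable_not:
  assumes "definable P" shows "definable (\<lambda>x y z i. \<not> P x y z i)"
proof -
  obtain \<phi> where "\<And>w i. ltl_holds w i \<phi> = P (tracks w VarX) (tracks w VarY) (tracks w VarZ) i"
    using assms unfolding definable_def by blast
  then show ?thesis by (intro definableI[of "LNot \<phi>"]) simp
qed

lemma definable_conj:
  assumes "definable P" "definable Q" shows "definable (\<lambda>x y z i. P x y z i \<and> Q x y z i)"
proof -
  obtain \<phi> \<psi> where "\<And>w i. ltl_holds w i \<phi> = P (tracks w VarX) (tracks w VarY) (tracks w VarZ) i"
    "\<And>w i. ltl_holds w i \<psi> = Q (tracks w VarX) (tracks w VarY) (tracks w VarZ) i"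
    using assms unfolding definable_def by blast
  then show ?thesis by (intro definableI[of "LAnd \<phi> \<psi>"]) simp
qed

lemma definable_until:
  assumes "definable P" "definable Q"
  shows "definable (\<lambda>x y z i. \<exists>j\<ge>i. Q x y z j \<and> (\<forall>k. i \<le> k \<and> k < j \<longrightarrow> P x y z k))"
proof -
  obtain \<phi> \<psi> where "\<And>w i. ltl_holds w i \<phi> = P (tracks w VarX) (tracks w VarY) (tracks w VarZ) i"
    "\<And>w i. ltl_holds w i \<psi> = Q (tracks w VarX) (tracks w VarY) (tracks w VarZ) i"
    using assms unfolding definable_def by blast
  then show ?thesis by (intro definableI[of "LUntil \<phi> \<psi>"]) simp
qed

lemma definable_disj:
  assumes "definable P" "definable Q" shows "definable (\<lambda>x y z i. P x y z i \<or> Q x y z i)"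
  using definable_not[OF definable_conj[OF assms[THEN definable_not]]] by simp

lemma definable_imp:
  assumes "definable P" "definable Q" shows "definable (\<lambda>x y z i. P x y z i \<longrightarrow> Q x y z i)"
  unfolding imp_conv_disj by (rule definable_disj[OF definable_not[OF assms(1)] assms(2)])

lemma definable_iff:
  assumes "definable P" "definable Q" shows "definable (\<lambda>x y z i. P x y z i = Q x y z i)"
  unfolding iff_conv_conj_imp by (rule definable_conj[OF definable_imp[OF assms] definable_imp[OF assms(2,1)]])

lemma definable_const: "definable (\<lambda>x y z i. c)"
  using definable_conj[OF definable_at(1) definable_not[OF definable_at(1)]]
    definable_disj[OF definable_at(1) definable_not[OF definable_at(1)]]
  by (cases c) simp_all

lemma definable_ball:
  assumes "finite A" "\<And>a. a \<in> A \<Longrightarrow> definable (P a)"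
  shows "definable (\<lambda>x y z i. \<forall>a\<in>A. P a x y z i)"
  using assms by (induction A) (simp_all add: definable_const definable_conj)

lemma definable_always:
  assumes "definable P" shows "definable (\<lambda>x y z i. \<forall>j\<ge>i. P x y z j)"
  using definable_not[OF definable_until[OF definable_const[of True] definable_not[OF assms]]]
  by simp

text \<open>Weak until: \<open>p\<close> holds before the first \<open>q\<close>, which need not
  exist, as an input may contain no pulse at all.\<close>

definition wuntil :: "(nat \<Rightarrow> bool) \<Rightarrow> (nat \<Rightarrow> bool) \<Rightarrow> nat \<Rightarrow> bool" where
  "wuntil p q i = (\<forall>j\<ge>i. p j \<or> (\<exists>k\<ge>i. k \<le> j \<and> q k))"

lemma definable_wuntil:
  assumes "definable P" "definable Q"
  shows "definable (\<lambda>x y z i. wuntil (P x y z) (Q x y z) i)"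
proof -
  have "wuntil p q i = (\<not> (\<exists>j\<ge>i. (\<not> p j \<and> \<not> q j) \<and> (\<forall>k. i \<le> k \<and> k < j \<longrightarrow> \<not> q k)))" for p q i
    unfolding wuntil_def by (metis le_neq_implies_less less_le_not_le order_refl)
  then show ?thesis
    using definable_not[OF definable_until[OF definable_not[OF assms(2)]
        definable_conj[OF assms[THEN definable_not]]]] by simp
qed

definition cell :: "nat \<Rightarrow> stream \<Rightarrow> nat \<Rightarrow> bool list" where
  "cell m f i = map (\<lambda>j. f (i + (7 + 2 * j))) [0..<m]"

lemma length_cell [simp]: "length (cell m f i) = m"
  by (simp add: cell_def)

lemma nth_cell: "j < m \<Longrightarrow> cell m f i ! j = f (i + (7 + 2 * j))"
  by (simp add: cell_def)

lemma cell_eq_iff: "length c = m \<Longrightarrow> cell m f i = c \<longleftrightarrow> (\<forall>j\<in>{..<m}. f (i + (7 + 2 * j)) = c ! j)"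
  by (auto simp: list_eq_iff_nth_eq nth_cell)

lemma cells_eq_iff: "cell m f i = cell m g i' \<longleftrightarrow> (\<forall>j\<in>{..<m}. f (i + (7 + 2 * j)) = g (i' + (7 + 2 * j)))"
  by (auto simp: list_eq_iff_nth_eq nth_cell)

text \<open>Cells are words of fixed length, so a case distinction over their contents is a finite
  conjunction; thus arbitrary predicates on cells become expressible.\<close>

lemma definable_cell_aux:
  assumes "\<And>c. definable (P c)" "\<And>j. definable (\<lambda>x y z i. f x y z (i + j))"
  shows "definable (\<lambda>x y z i. P (cell m (f x y z) (i + n)) x y z i)"
proof -
  have "definable (\<lambda>x y z i. \<forall>c\<in>{c. set c \<subseteq> UNIV \<and> length c = m}.
     (\<forall>j\<in>{..<m}. f x y z (i + (n + (7 + 2 * j))) = c ! j) \<longrightarrow> P c x y z i)"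
    by (intro definable_ball definable_imp definable_iff definable_const finite_lists_length_eq assms) simp_all
  moreover have "(\<forall>c\<in>{c. set c \<subseteq> UNIV \<and> length c = m}.
     (\<forall>j\<in>{..<m}. f x y z (i + (n + (7 + 2 * j))) = c ! j) \<longrightarrow> P c x y z i) =
     P (cell m (f x y z) (i + n)) x y z i" for x y z i
  proof -
    have "(\<forall>j\<in>{..<m}. f x y z (i + (n + (7 + 2 * j))) = c ! j) = (cell m (f x y z) (i + n) = c)"
      if "length c = m" for c
      using that by (simp add: cell_eq_iff add.assoc)
    then show ?thesis by auto
  qed
  ultimately show ?thesis by simp
qed

lemma definable_cell_y:
  "(\<And>c. definable (P c)) \<Longrightarrow> definable (\<lambda>x y z i. P (cell m y (i + n)) x y z i)"
  by (rule definable_cell_aux[where f = "\<lambda>x y z. y"]) (assumption, rule definable_at)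

lemma definable_cell_z:
  "(\<And>c. definable (P c)) \<Longrightarrow> definable (\<lambda>x y z i. P (cell m z (i + n)) x y z i)"
  by (rule definable_cell_aux[where f = "\<lambda>x y z. z"]) (assumption, rule definable_at)

lemma definable_cell_y0:
  "(\<And>c. definable (P c)) \<Longrightarrow> definable (\<lambda>x y z i. P (cell m y i) x y z i)"
  using definable_cell_y[of P m 0] by simp

lemma definable_cell_z0:
  "(\<And>c. definable (P c)) \<Longrightarrow> definable (\<lambda>x y z i. P (cell m z i) x y z i)"
  using definable_cell_z[of P m 0] by simp

lemma definable_V:
  "definable (\<lambda>x y z i. V (cell m y i) (cell m y (i + n)) (cell m z i) (cell m z (i + n)))"
  by (rule definable_cell_y0[where P = "\<lambda>a x y z i. V a (cell m y (i + n)) (cell m z i) (cell m z (i + n))"],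
      rule definable_cell_y[where P = "\<lambda>b x y z i. V _ b (cell m z i) (cell m z (i + n))"],
      rule definable_cell_z0[where P = "\<lambda>c x y z i. V _ _ c (cell m z (i + n))"],
      rule definable_cell_z[where P = "\<lambda>d x y z i. V _ _ _ d"], rule definable_const)

section \<open>Systems over S0 as iterated transducers\<close>

primrec mrun :: "('q, inp, outp) moore \<Rightarrow> stream \<Rightarrow> nat \<Rightarrow> 'q" where
  "mrun M x 0 = init M"
| "mrun M x (Suc k) = delta M (mrun M x k) (if x k then {PropA} else {})"

definition transd :: "('q, inp, outp) moore \<Rightarrow> stream \<Rightarrow> stream" where
  "transd M x k = (PropB \<in> lab M (mrun M x k))"

lemma mrun_causal: "(\<And>j. j < k \<Longrightarrow> u j = v j) \<Longrightarrow> mrun M u k = mrun M v k"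
  by (induction k) simp_all

text \<open>A Moore machine emits its label before reading the current letter, so only strictly
  earlier inputs matter. The induction over bits in \<open>settled\<close> rests on this
  strictness.\<close>

lemma transd_causal: "(\<And>j. j < k \<Longrightarrow> u j = v j) \<Longrightarrow> transd M u k = transd M v k"
  by (simp add: transd_def mrun_causal[of k u v])

lemma UNIV_inp: "(UNIV :: inp set) = {PropA}"
  using inp.exhaust by auto

lemma true_sigs_S0:
  "(VarX \<in> true_sigs S0 M f) = False" "(VarY \<in> true_sigs S0 M f) = (PropB \<in> lab M (f Proc0))"
  "(VarZ \<in> true_sigs S0 M f) = (PropB \<in> lab M (f Proc1))"
proof -
  have U: "(UNIV :: proc set) = {Proc0, Proc1}" using proc.exhaust by auto
  have "(\<exists>ob\<in>L. Q) = (PropB \<in> L \<and> Q)" for L :: "outp set" and Q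
    by (metis outp.exhaust empty_iff)
  then show "(VarX \<in> true_sigs S0 M f) = False" "(VarY \<in> true_sigs S0 M f) = (PropB \<in> lab M (f Proc0))"
    "(VarZ \<in> true_sigs S0 M f) = (PropB \<in> lab M (f Proc1))"
    by (auto simp: true_sigs_def S0_def U split: if_splits)
qed

lemma comp_run_S0:
  assumes "\<And>k. w k \<subseteq> {VarX}"
  shows "comp_run S0 M w k Proc0 = mrun M (tracks w VarX) k \<and>
    comp_run S0 M w k Proc1 = mrun M (transd M (tracks w VarX)) k"
proof (induction k)
  case (Suc k)
  have [simp]: "Ein S0 Proc0 i = VarX" "Ein S0 Proc1 i = VarY" for i by (simp_all add: S0_def)
  have "VarY \<notin> w k" using assms[of k] by auto
  then show ?case
    using Suc by (simp add: comp_step_def true_sigs_S0 transd_def tracks_def UNIV_inp)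
qed simp

lemma tracks_comp_trace:
  assumes "\<And>k. w k \<subseteq> {VarX}"
  shows "tracks (comp_trace S0 M w) VarX = tracks w VarX"
    "tracks (comp_trace S0 M w) VarY = transd M (tracks w VarX)"
    "tracks (comp_trace S0 M w) VarZ = transd M (transd M (tracks w VarX))"
proof -
  have "VarY \<notin> w k" "VarZ \<notin> w k" for k using assms[of k] by auto
  then show "tracks (comp_trace S0 M w) VarX = tracks w VarX"
    "tracks (comp_trace S0 M w) VarY = transd M (tracks w VarX)"
    "tracks (comp_trace S0 M w) VarZ = transd M (transd M (tracks w VarX))"
    using comp_run_S0[OF assms, of M]
    by (auto simp: tracks_def comp_trace_def true_sigs_S0 transd_def)
qed

lemma sys_satisfies_S0_0:
  assumes "\<And>w. ltl_holds w 0 \<phi> = P (tracks w VarX) (tracks w VarY) (tracks w VarZ)"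
  shows "sys_satisfies S0 M \<phi> \<longleftrightarrow> (\<forall>x. P x (transd M x) (transd M (transd M x)))"
proof -
  have gins: "gins S0 = {VarX}" by (simp add: S0_def)
  have "sys_satisfies S0 M \<phi> \<longleftrightarrow> (\<forall>w. (\<forall>k. w k \<subseteq> {VarX}) \<longrightarrow>
     P (tracks w VarX) (transd M (tracks w VarX)) (transd M (transd M (tracks w VarX))))"
    unfolding sys_satisfies_def ltl_sat_def assms gins by (simp add: tracks_comp_trace)
  also have "\<dots> \<longleftrightarrow> (\<forall>x. P x (transd M x) (transd M (transd M x)))"
  proof (intro iffI allI)
    fix x assume h: "\<forall>w. (\<forall>k. w k \<subseteq> {VarX}) \<longrightarrow>
     P (tracks w VarX) (transd M (tracks w VarX)) (transd M (transd M (tracks w VarX)))"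
    have "tracks (\<lambda>k. if x k then {VarX} else {}) VarX = x" by (auto simp: tracks_def)
    then show "P x (transd M x) (transd M (transd M x))"
      using h[rule_format, of "\<lambda>k. if x k then {VarX} else {}"] by auto
  qed simp
  finally show ?thesis .
qed

text \<open>The machine built later has tuples as states, whereas \<open>S0_realizable\<close>
  quantifies over machines on natural numbers.\<close>

lemma finite_moore_nat:
  fixes N :: "('q, inp, outp) moore"
  assumes "finite_moore N"
  obtains M :: "(nat, inp, outp) moore" where "finite_moore M" "transd M = transd N"
proof -
  obtain Q where Q: "finite Q" "init N \<in> Q" "\<And>q I. q \<in> Q \<Longrightarrow> delta N q I \<in> Q"
    using assms unfolding finite_moore_def by blast
  obtain f :: "'q \<Rightarrow> nat" where f: "inj_on f Q" using finite_imp_inj_to_nat_seg[OF Q(1)] by blast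
  let ?g = "inv_into Q f"
  let ?M = "\<lparr>delta = \<lambda>n I. f (delta N (?g n) I), init = f (init N), lab = \<lambda>n. lab N (?g n)\<rparr>"
  have "finite_moore ?M"
    unfolding finite_moore_def using Q f by (intro exI[of _ "f ` Q"]) auto
  moreover have "mrun N x k \<in> Q \<and> mrun ?M x k = f (mrun N x k)" for x k
    by (induction k) (simp_all add: Q f)
  then have "transd ?M = transd N" by (simp add: transd_def fun_eq_iff f)
  ultimately show ?thesis by (rule that)
qed

section \<open>The specification\<close>

text \<open>The cell constraints stay abstract: \<open>Q1\<close> for the first cell,
  \<open>Q2\<close> for neighbours up to a flagged cell, \<open>Q3\<close> for neighbours
  everywhere, and \<open>V\<close> for two neighbours of a row followed by the cells in the same
  columns one row earlier.\<close>

locale layout =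
  fixes m :: nat
    and Q1 :: "bool list \<Rightarrow> bool"
    and Q2 Q3 :: "bool list \<Rightarrow> bool list \<Rightarrow> bool"
    and V :: "bool list \<Rightarrow> bool list \<Rightarrow> bool list \<Rightarrow> bool list \<Rightarrow> bool"
  assumes m2: "2 \<le> m"
begin

text \<open>Streams are cut into frames of \<open>w\<close> steps. Offsets 0 and 1 of a frame hold a one, and no
  other two consecutive steps do; this header makes the frames visible to LTL, which cannot count
  modulo \<open>w\<close>. Offset 3 carries \<open>K\<close>-pulses and the later pulses, offset 5 carries \<open>D\<close>-pulses,
  and offset \<open>7 + 2 * i\<close> carries bit \<open>i\<close> of a cell. Since the \<open>D\<close> slot comes after the \<open>K\<close> slot
  and before the cell, a \<open>K\<close> can be relayed as a \<open>D\<close> without losing a frame, and two plays that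
  start in the same frame are output simultaneously.\<close>

definition w :: nat where "w = 7 + 2 * m"

definition H :: "stream \<Rightarrow> nat \<Rightarrow> bool" where "H y i = (y i \<and> y (i + 1))"

definition clock :: "stream \<Rightarrow> nat \<Rightarrow> bool" where
  "clock y i = (H y i \<and> (\<forall>j\<ge>i. H y j \<longrightarrow> H y (j + w) \<and> (\<forall>l\<in>{1..m+3}. \<not> y (j + 2 * l))))"

text \<open>The slot at offset 3 is constrained one frame ahead because it answers to the previous
  frame; the one of frame 0 is settled in \<open>body\<close>.\<close>

definition pre :: "stream \<Rightarrow> stream \<Rightarrow> nat \<Rightarrow> bool" where
  "pre x y i = (H y i \<longrightarrow> \<not> x (i + 3) \<and> \<not> x (i + 5) \<and> \<not> y (i + 5) \<and> \<not> y (i + (w + 3)) \<and>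
     (\<forall>j\<in>{..<m}. \<not> y (i + (7 + 2 * j))))"

definition lagged :: "stream \<Rightarrow> stream \<Rightarrow> nat \<Rightarrow> nat \<Rightarrow> bool" where
  "lagged y z n i = (\<forall>j\<ge>i. H y j \<longrightarrow> (\<forall>l\<in>{..<m}. y (j + (7 + 2 * l)) = z (j + (n * w + (7 + 2 * l)))))"

definition vert :: "stream \<Rightarrow> stream \<Rightarrow> nat \<Rightarrow> bool" where
  "vert y z i = (\<forall>j\<ge>i. H y j \<longrightarrow> V (cell m y j) (cell m y (j + w)) (cell m z j) (cell m z (j + w)))"

definition relay :: "stream \<Rightarrow> stream \<Rightarrow> nat \<Rightarrow> bool" where
  "relay x y i = (\<forall>j\<ge>i. H y j \<longrightarrow> \<not> y (j + 5) \<and> y (j + (w + 3)) = x (j + 3))"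

text \<open>After a dropped D, the first later pulse starts the second process one frame after its
  arrival. If \<open>y\<close> flags the second row in that frame, \<open>z\<close> runs one row
  behind \<open>y\<close> and \<open>vert\<close> must hold. Forbidding the violation demands
  nothing when no such pulse comes.\<close>

definition unsucc :: "stream \<Rightarrow> stream \<Rightarrow> stream \<Rightarrow> nat \<Rightarrow> bool" where
  "unsucc x y z i = (\<exists>j\<ge>i. (H y j \<and> x (j + 3) \<and> y (j + (w + 9)) \<and> \<not> vert y z (j + w)) \<and>
     (\<forall>k. i \<le> k \<and> k < j \<longrightarrow> H y k \<longrightarrow> \<not> x (k + 3)))"

text \<open>In the cases of \<open>lagged\<close> below, the pulse that arrives 2 or 3 frames after the \<open>D\<close> reaches the
  second process one frame later, whence the lags 3 and 4. Both are needed because start times can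
  be compared only if they differ by a combination of lags. Bit 1 of a cell (offset 9) flags the
  beginning of the second row.\<close>

definition event :: "stream \<Rightarrow> stream \<Rightarrow> stream \<Rightarrow> nat \<Rightarrow> bool" where
  "event x y z i = (H y i \<and> (x (i + 3) \<or> x (i + 5)) \<and> y (i + 5) = x (i + 3) \<and> \<not> y (i + (w + 3)) \<and>
     relay x y (i + 1) \<and>
     (x (i + 3) \<longrightarrow> lagged y z 0 i) \<and>
     (\<not> x (i + 3) \<and> \<not> x (i + (w + 3)) \<and> x (i + (2 * w + 3)) \<longrightarrow> lagged y z 3 i) \<and>
     (\<not> x (i + 3) \<and> \<not> x (i + (w + 3)) \<and> \<not> x (i + (2 * w + 3)) \<and> x (i + (3 * w + 3)) \<longrightarrow> lagged y z 4 i) \<and>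
     (\<not> x (i + 3) \<longrightarrow> \<not> unsucc x y z (i + 1)))"

text \<open>Three unflagged cells at the beginning force rows of length at least 3, as
  \<open>G_vertical\<close> requires; the last conjunct makes sure that a flag occurs.\<close>

definition horiz :: "stream \<Rightarrow> nat \<Rightarrow> bool" where
  "horiz y i = (\<not> y (i + 9) \<and> \<not> y (i + (w + 9)) \<and> \<not> y (i + (2 * w + 9)) \<and> Q1 (cell m y i) \<and>
     (\<forall>j\<ge>i. H y j \<longrightarrow> Q3 (cell m y j) (cell m y (j + w))) \<and>
     (\<exists>j\<ge>i. (H y j \<and> y (j + 9)) \<and> (\<forall>k. i \<le> k \<and> k < j \<longrightarrow> H y k \<longrightarrow> Q2 (cell m y k) (cell m y (k + w)))))"

text \<open>To be read at position 0: \<open>horiz\<close> is tested only for a K in the first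
  frame, and later starts are tied to that play through \<open>event\<close>.\<close>

definition body :: "stream \<Rightarrow> stream \<Rightarrow> stream \<Rightarrow> nat \<Rightarrow> bool" where
  "body x y z i = (clock y i \<and> \<not> y (i + 3) \<and> wuntil (pre x y) (event x y z) i \<and> (x (i + 3) \<longrightarrow> horiz y i))"

lemma definable_H: "definable (\<lambda>x y z i. H y i)"
  unfolding H_def by (intro definable_conj definable_at)

lemma definable_imp_H:
  "definable P \<Longrightarrow> definable (\<lambda>x y z i. H y i \<longrightarrow> P x y z i)"
  by (intro definable_imp definable_H)

lemma definable_clock: "definable (\<lambda>x y z i. clock y i)"
  unfolding clock_def
  by (intro definable_conj definable_H definable_always definable_imp_H definable_ball definable_not definable_at
      definable_shift[OF definable_H]) simp

lemma definable_pre: "definable (\<lambda>x y z i. pre x y i)"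
  unfolding pre_def
  by (intro definable_imp_H definable_conj definable_not definable_at definable_ball) simp

lemma definable_lagged: "definable (\<lambda>x y z i. lagged y z n i)"
  unfolding lagged_def
  by (intro definable_always definable_imp_H definable_ball definable_iff definable_at) simp

lemma definable_vert: "definable (\<lambda>x y z i. vert y z i)"
  unfolding vert_def by (intro definable_always definable_imp_H definable_V)

lemma definable_relay: "definable (\<lambda>x y z i. relay x y i)"
  unfolding relay_def by (intro definable_always definable_imp_H definable_conj definable_not definable_iff definable_at)

lemma definable_unsucc: "definable (\<lambda>x y z i. unsucc x y z i)"
  unfolding unsucc_def
  by (intro definable_until definable_conj definable_H definable_imp_H definable_not definable_at
      definable_shift[OF definable_vert])

lemma definable_event: "definable (\<lambda>x y z i. event x y z i)"
  unfolding event_def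
  by (intro definable_conj definable_H definable_not definable_at definable_imp definable_disj definable_iff
      definable_lagged definable_shift[OF definable_relay] definable_shift[OF definable_unsucc])

lemma definable_horiz: "definable (\<lambda>x y z i. horiz y i)"
proof -
  have Q: "definable (\<lambda>x y z i. Q (cell m y i) (cell m y (i + w)))" for Q
    using definable_V[of "\<lambda>a b c d. Q a b" m w] by simp
  show ?thesis unfolding horiz_def
    by (intro definable_conj definable_not definable_at definable_always definable_imp_H definable_until
        definable_H Q definable_V[of "\<lambda>a b c d. Q1 a" m 0])
qed

lemma definable_body: "definable body"
  unfolding body_def
  by (intro definable_conj definable_clock definable_not definable_at definable_imp definable_horiz
      definable_wuntil definable_pre definable_event)

section \<open>The specification read frame by frame\<close>

definition kap :: "stream \<Rightarrow> nat \<Rightarrow> bool" where "kap f t = f (w * t + 3)"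
definition del :: "stream \<Rightarrow> nat \<Rightarrow> bool" where "del f t = f (w * t + 5)"
definition cel :: "stream \<Rightarrow> nat \<Rightarrow> bool list" where "cel f t = cell m f (w * t)"

lemma length_cel [simp]: "length (cel f t) = m"
  by (simp add: cel_def)

lemma nth_cel: "i < m \<Longrightarrow> cel f t ! i = f (w * t + (7 + 2 * i))"
  by (simp add: cel_def nth_cell)

definition fpre :: "stream \<Rightarrow> stream \<Rightarrow> nat \<Rightarrow> bool" where
  "fpre x y t = (\<not> kap x t \<and> \<not> del x t \<and> \<not> del y t \<and> \<not> kap y (Suc t) \<and> cel y t = replicate m False)"

definition fevent :: "stream \<Rightarrow> stream \<Rightarrow> stream \<Rightarrow> nat \<Rightarrow> bool" where
  "fevent x y z t = ((kap x t \<or> del x t) \<and> del y t = kap x t \<and> \<not> kap y (Suc t) \<and>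
     (\<forall>u>t. \<not> del y u \<and> kap y (Suc u) = kap x u) \<and>
     (kap x t \<longrightarrow> (\<forall>u\<ge>t. cel y u = cel z u)) \<and>
     (\<not> kap x t \<and> \<not> kap x (t + 1) \<and> kap x (t + 2) \<longrightarrow> (\<forall>u\<ge>t. cel y u = cel z (u + 3))) \<and>
     (\<not> kap x t \<and> \<not> kap x (t + 1) \<and> \<not> kap x (t + 2) \<and> kap x (t + 3) \<longrightarrow> (\<forall>u\<ge>t. cel y u = cel z (u + 4))) \<and>
     (\<not> kap x t \<longrightarrow> (\<forall>e>t. kap x e \<and> cel y (Suc e) ! 1 \<and> (\<forall>u. t < u \<and> u < e \<longrightarrow> \<not> kap x u) \<longrightarrow>
        (\<forall>u>e. V (cel y u) (cel y (Suc u)) (cel z u) (cel z (Suc u))))))"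

definition fhoriz :: "(nat \<Rightarrow> bool list) \<Rightarrow> bool" where
  "fhoriz G = ((\<forall>k<3. \<not> G k ! 1) \<and> Q1 (G 0) \<and> (\<forall>k. Q3 (G k) (G (Suc k))) \<and>
     (\<exists>L. G L ! 1 \<and> (\<forall>k<L. Q2 (G k) (G (Suc k)))))"

definition fbody :: "stream \<Rightarrow> stream \<Rightarrow> stream \<Rightarrow> bool" where
  "fbody x y z = (clock y 0 \<and> \<not> kap y 0 \<and> (\<forall>t. fpre x y t \<or> (\<exists>u\<le>t. fevent x y z u)) \<and>
     (kap x 0 \<longrightarrow> fhoriz (cel y)))"

lemma clock_frame:
  assumes "clock y 0"
  shows "H y (w * t)" "l \<in> {1..m+3} \<Longrightarrow> \<not> y (w * t + 2 * l)"
proof -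
  have *: "H y (w * t)" for t
  proof (induction t)
    case 0
    then show ?case using assms by (simp add: clock_def)
  next
    case (Suc t)
    then have "H y (w * t + w)" using assms by (simp add: clock_def)
    then show ?case by (simp add: add.commute)
  qed
  then show "H y (w * t)" .
  show "\<not> y (w * t + 2 * l)" if "l \<in> {1..m+3}"
    using * assms that by (simp add: clock_def)
qed

lemma frame_cases:
  obtains t r where "i = w * t + r" "r < w"
proof -
  have "i = w * (i div w) + i mod w" by simp
  moreover have "i mod w < w" by (simp add: w_def)
  ultimately show ?thesis by (rule that)
qed

text \<open>Any two neighbouring offsets other than 0 and 1 include one of the even offsets 2 to
  \<open>w - 1\<close>, which \<open>clock\<close> keeps false; this covers the pair that reaches
  into the next frame.\<close>

lemma H_iff:
  assumes "clock y 0" shows "H y i \<longleftrightarrow> (\<exists>t. i = w * t)"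
proof
  assume h: "H y i"
  obtain t r where i: "i = w * t + r" "r < w" by (rule frame_cases)
  have "r = 0"
  proof (rule ccontr)
    assume "r \<noteq> 0"
    show False
    proof (cases "even r")
      case True
      then obtain l where "r = 2 * l" by auto
      with clock_frame(2)[OF assms, of l t] h i \<open>r \<noteq> 0\<close> show False by (simp add: H_def w_def)
    next
      case False
      then obtain l where "r + 1 = 2 * l" by (metis even_Suc evenE Suc_eq_plus1)
      moreover from this have "l \<in> {1..m+3}" using i by (simp add: w_def)
      moreover have "i + 1 = w * t + (r + 1)" using i by simp
      ultimately show False using clock_frame(2)[OF assms, of l t] h by (simp add: H_def)
    qed
  qed
  then show "\<exists>t. i = w * t" using i by simp
qed (use clock_frame(1)[OF assms] in auto)

lemma w_pos: "0 < w" by (simp add: w_def)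

lemma w_less_iff: "w * t < w * u \<longleftrightarrow> t < u"
  using w_pos by simp

lemma w_le_iff: "w * t \<le> w * u \<longleftrightarrow> t \<le> u"
  using w_pos by simp

lemma frames_from:
  assumes "clock y 0"
  shows "(\<forall>j\<ge>a. H y j \<longrightarrow> P j) \<longleftrightarrow> (\<forall>u. a \<le> w * u \<longrightarrow> P (w * u))"
    "(\<exists>j\<ge>a. (H y j \<and> P j) \<and> R j) \<longleftrightarrow> (\<exists>u. a \<le> w * u \<and> P (w * u) \<and> R (w * u))"
    "(\<forall>k. a \<le> k \<and> k < b \<longrightarrow> H y k \<longrightarrow> P k) \<longleftrightarrow> (\<forall>u. a \<le> w * u \<and> w * u < b \<longrightarrow> P (w * u))"
  unfolding H_iff[OF assms] by auto

lemma all_frames: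
  assumes "clock y 0"
  shows "(\<forall>j\<ge>w * t. H y j \<longrightarrow> P j) \<longleftrightarrow> (\<forall>u\<ge>t. P (w * u))"
    "(\<forall>j\<ge>w * t + 1. H y j \<longrightarrow> P j) \<longleftrightarrow> (\<forall>u>t. P (w * u))"
  unfolding frames_from[OF assms]
  unfolding w_le_iff Suc_eq_plus1[symmetric] Suc_le_eq w_less_iff by simp_all

lemma lagged_frames:
  assumes "clock y 0"
  shows "lagged y z n (w * t) \<longleftrightarrow> (\<forall>u\<ge>t. cel y u = cel z (u + n))"
proof -
  have "(\<forall>l\<in>{..<m}. y (w * u + (7 + 2 * l)) = z (w * u + (n * w + (7 + 2 * l)))) \<longleftrightarrow> cel y u = cel z (u + n)" for u
    unfolding cel_def cells_eq_iff by (simp add: algebra_simps)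
  then show ?thesis unfolding lagged_def all_frames(1)[OF assms] by simp
qed

lemma next_frame: "w * u + w = w * Suc u" "w * u + (w + n) = w * Suc u + n" by simp_all

lemma vert_frames:
  assumes "clock y 0"
  shows "vert y z (w * t) \<longleftrightarrow> (\<forall>u\<ge>t. V (cel y u) (cel y (Suc u)) (cel z u) (cel z (Suc u)))"
  unfolding vert_def all_frames(1)[OF assms] cel_def next_frame ..

lemma relay_frames:
  assumes "clock y 0"
  shows "relay x y (w * t + 1) \<longleftrightarrow> (\<forall>u>t. \<not> del y u \<and> kap y (Suc u) = kap x u)"
  using all_frames(2)[OF assms] by (simp add: relay_def del_def kap_def next_frame)

lemma cel_flag: "cel y t ! 1 = y (w * t + 9)"
  using m2 by (simp add: nth_cel)

lemma unsucc_frames: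
  assumes "clock y 0"
  shows "unsucc x y z (w * t + 1) \<longleftrightarrow> (\<exists>e>t. (kap x e \<and> cel y (Suc e) ! 1 \<and> \<not> vert y z (w * Suc e)) \<and>
     (\<forall>u. t < u \<and> u < e \<longrightarrow> \<not> kap x u))"
proof -
  have "unsucc x y z (w * t + 1) \<longleftrightarrow> (\<exists>e>t. (x (w * e + 3) \<and> y (w * Suc e + 9) \<and> \<not> vert y z (w * Suc e)) \<and>
     (\<forall>u. t < u \<and> u < e \<longrightarrow> \<not> x (w * u + 3)))"
    unfolding unsucc_def frames_from[OF assms]
    unfolding Suc_eq_plus1[symmetric] Suc_le_eq w_less_iff next_frame by simp
  then show ?thesis by (simp only: cel_flag kap_def)
qed

lemma pre_frames:
  assumes "clock y 0"
  shows "pre x y (w * t) \<longleftrightarrow> fpre x y t"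
proof -
  have "(\<forall>j\<in>{..<m}. \<not> y (w * t + (7 + 2 * j))) \<longleftrightarrow> cel y t = replicate m False"
    unfolding cel_def by (subst cell_eq_iff) auto
  then show ?thesis using clock_frame(1)[OF assms]
    by (simp add: pre_def fpre_def kap_def del_def next_frame)
qed

lemma event_frames:
  assumes "clock y 0"
  shows "event x y z (w * t) \<longleftrightarrow> fevent x y z t"
proof -
  have k: "w * t + (w + 3) = w * (t + 1) + 3" "w * t + (2 * w + 3) = w * (t + 2) + 3"
    "w * t + (3 * w + 3) = w * (t + 3) + 3" by (simp_all add: algebra_simps)
  have "(\<forall>u\<ge>Suc e. V (cel y u) (cel y (Suc u)) (cel z u) (cel z (Suc u))) \<longleftrightarrow>
    (\<forall>u>e. V (cel y u) (cel y (Suc u)) (cel z u) (cel z (Suc u)))" for e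
    by (simp add: Suc_le_eq)
  then have "unsucc x y z (w * t + 1) \<longleftrightarrow> \<not> (\<forall>e>t. kap x e \<and> cel y (Suc e) ! 1 \<and>
     (\<forall>u. t < u \<and> u < e \<longrightarrow> \<not> kap x u) \<longrightarrow> (\<forall>u>e. V (cel y u) (cel y (Suc u)) (cel z u) (cel z (Suc u))))"
    unfolding unsucc_frames[OF assms] vert_frames[OF assms] by auto
  then have u: "(\<not> kap x t \<longrightarrow> \<not> unsucc x y z (w * t + 1)) \<longleftrightarrow> (\<not> kap x t \<longrightarrow> (\<forall>e>t. kap x e \<and> cel y (Suc e) ! 1 \<and>
     (\<forall>u. t < u \<and> u < e \<longrightarrow> \<not> kap x u) \<longrightarrow> (\<forall>u>e. V (cel y u) (cel y (Suc u)) (cel z u) (cel z (Suc u)))))"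
    by blast
  show ?thesis
    unfolding event_def fevent_def k lagged_frames[OF assms] relay_frames[OF assms]
      kap_def[symmetric] del_def[symmetric] u Suc_eq_plus1 add_0_right
    using clock_frame(1)[OF assms, of t] by simp
qed

lemma horiz_frames:
  assumes "clock y 0"
  shows "horiz y 0 \<longleftrightarrow> fhoriz (cel y)"
proof -
  have S: "(\<forall>k<3. \<not> cel y k ! 1) \<longleftrightarrow> \<not> y (0 + 9) \<and> \<not> y (0 + (w + 9)) \<and> \<not> y (0 + (2 * w + 9))"
  proof -
    have *: "(\<forall>k<3. P k) \<longleftrightarrow> P 0 \<and> P 1 \<and> P 2" for P :: "nat \<Rightarrow> bool"
      by (simp add: numeral_3_eq_3 numeral_2_eq_2 All_less_Suc) blast
    show ?thesis unfolding * cel_flag by (simp add: mult.commute)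
  qed
  have Q: "(\<forall>j\<ge>0. H y j \<longrightarrow> Q3 (cell m y j) (cell m y (j + w))) \<longleftrightarrow> (\<forall>k. Q3 (cel y k) (cel y (Suc k)))"
    using all_frames(1)[OF assms, of 0] by (simp add: cel_def next_frame)
  have L: "(\<exists>j\<ge>0. (H y j \<and> y (j + 9)) \<and> (\<forall>k. 0 \<le> k \<and> k < j \<longrightarrow> H y k \<longrightarrow> Q2 (cell m y k) (cell m y (k + w)))) \<longleftrightarrow>
    (\<exists>L. cel y L ! 1 \<and> (\<forall>k<L. Q2 (cel y k) (cel y (Suc k))))"
    unfolding frames_from[OF assms] w_less_iff next_frame cel_flag by (simp add: cel_def)
  have "cell m y 0 = cel y 0" by (simp add: cel_def)
  then show ?thesis
    unfolding horiz_def fhoriz_def Q S L by simp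
qed

lemma body_frames: "body x y z 0 \<longleftrightarrow> fbody x y z"
proof (cases "clock y 0")
  case c: True
  have "wuntil (pre x y) (event x y z) 0 \<longleftrightarrow> (\<forall>t. fpre x y t \<or> (\<exists>u\<le>t. fevent x y z u))"
  proof
    assume h: "wuntil (pre x y) (event x y z) 0"
    show "\<forall>t. fpre x y t \<or> (\<exists>u\<le>t. fevent x y z u)"
    proof
      fix t
      have "pre x y (w * t) \<or> (\<exists>k\<le>w * t. event x y z k)" using h by (auto simp: wuntil_def)
      moreover have "\<exists>u\<le>t. fevent x y z u" if k: "k \<le> w * t" "event x y z k" for k
      proof -
        have "H y k" using k(2) by (simp add: event_def)
        then obtain u where "k = w * u" using H_iff[OF c] by auto
        then show ?thesis using k event_frames[OF c] w_le_iff by blast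
      qed
      ultimately show "fpre x y t \<or> (\<exists>u\<le>t. fevent x y z u)"
        using pre_frames[OF c] by blast
    qed
  next
    assume h: "\<forall>t. fpre x y t \<or> (\<exists>u\<le>t. fevent x y z u)"
    show "wuntil (pre x y) (event x y z) 0"
      unfolding wuntil_def
    proof (intro allI impI)
      fix j
      show "pre x y j \<or> (\<exists>k\<ge>0. k \<le> j \<and> event x y z k)"
      proof (cases "H y j")
        case True
        then obtain t where j: "j = w * t" using H_iff[OF c] by auto
        from h have "fpre x y t \<or> (\<exists>u\<le>t. fevent x y z u)" ..
        then show ?thesis
        proof
          assume "\<exists>u\<le>t. fevent x y z u"
          then obtain u where "u \<le> t" "event x y z (w * u)" using event_frames[OF c] by blast
          then show ?thesis using j w_le_iff by blast
        qed (simp add: j pre_frames[OF c])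
      qed (simp add: pre_def)
    qed
  qed
  then show ?thesis using horiz_frames[OF c] c by (simp add: body_def fbody_def kap_def)
qed (simp add: body_def fbody_def)

end

section \<open>All late plays coincide\<close>

context layout
begin

section \<open>Streams assembled from frame contents\<close>

definition mk :: "(nat \<Rightarrow> bool) \<Rightarrow> (nat \<Rightarrow> bool) \<Rightarrow> (nat \<Rightarrow> bool list) \<Rightarrow> stream" where
  "mk k d c i = (let t = i div w; r = i mod w in
     if r \<le> 1 then True else if r = 3 then k t else if r = 5 then d t
     else odd r \<and> c t ! ((r - 7) div 2))"

lemma mk_at:
  assumes "r < w"
  shows "mk k d c (w * t + r) = (if r \<le> 1 then True else if r = 3 then k t else if r = 5 then d t
     else odd r \<and> c t ! ((r - 7) div 2))"
  using assms by (simp add: mk_def)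

lemma kap_mk [simp]: "kap (mk k d c) = k" and del_mk [simp]: "del (mk k d c) = d"
proof -
  have "3 < w" "5 < w" by (simp_all add: w_def)
  then show "kap (mk k d c) = k" "del (mk k d c) = d"
    by (simp_all add: kap_def del_def mk_at fun_eq_iff)
qed

lemma mk_cell: "i < m \<Longrightarrow> mk k d c (w * t + (7 + 2 * i)) = c t ! i"
  by (subst mk_at) (auto simp: w_def)

lemma odd_offset:
  assumes "odd r" "r < w" "r \<noteq> 1" "r \<noteq> 3" "r \<noteq> 5"
  obtains i where "r = 7 + 2 * i" "i < m"
proof -
  obtain l where l: "r = 2 * l + 1" using assms(1) by (auto elim: oddE)
  then have "l \<ge> 3" using assms by (cases l; cases "l - 1"; cases "l - 2") auto
  then show ?thesis using l assms(2) by (intro that[of "l - 3"]) (auto simp: w_def)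
qed

text \<open>Headers and even offsets are fixed by \<open>clock\<close>, so the two pulse slots and
  the cells determine the stream. Outputs can thus be recognised as inputs of a known shape.\<close>

lemma clock_mk:
  assumes "clock y 0" "k = kap y" "d = del y"
  shows "y = mk k d (cel y)"
proof
  fix i
  obtain t r where i: "i = w * t + r" "r < w" by (rule frame_cases)
  have H: "y (w * t)" "y (w * t + 1)" using clock_frame(1)[OF assms(1), of t] by (auto simp: H_def)
  show "y i = mk k d (cel y) i"
  proof (cases "r = 0 \<or> r = 1 \<or> r = 3 \<or> r = 5")
    case True
    then show ?thesis using i H by (auto simp: mk_at assms(2,3) kap_def del_def)
  next
    case False
    show ?thesis
    proof (cases "even r")
      case True
      then obtain l where l: "r = 2 * l" by (auto elim: evenE)
      then have "\<not> y (w * t + 2 * l)"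
        using i(2) False by (intro clock_frame(2)[OF assms(1)]) (auto simp: w_def)
      then show ?thesis unfolding i(1) using True False l i(2) by (subst mk_at) auto
    next
      case odd: False
      obtain j where "r = 7 + 2 * j" "j < m" by (rule odd_offset[OF odd i(2)]) (use False in auto)
      then show ?thesis unfolding i(1) by (simp only: mk_cell nth_cel)
    qed
  qed
qed

text \<open>Later pulses are recorded by their distances \<open>A\<close> from the start, so that
  relaying acts on start and distances by simple maps, as \<open>F_K\<close> and \<open>F_D\<close>
  show.\<close>

definition K :: "nat \<Rightarrow> nat set \<Rightarrow> (nat \<Rightarrow> bool list) \<Rightarrow> stream" where
  "K s A c = mk (\<lambda>t. t = s \<or> (s < t \<and> t - s \<in> A)) (\<lambda>_. False) c"

definition D :: "nat \<Rightarrow> nat set \<Rightarrow> (nat \<Rightarrow> bool list) \<Rightarrow> stream" where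
  "D s A c = mk (\<lambda>t. s < t \<and> t - s \<in> A) (\<lambda>t. t = s) c"

text \<open>The tail seen from \<open>n\<close> frames before a pulse that is itself followed by the
  tail \<open>A\<close>.\<close>

definition adj :: "nat \<Rightarrow> nat set \<Rightarrow> nat set" where
  "adj n A = insert n ((+) n ` A)"

lemma adj_not0: "0 \<notin> A \<Longrightarrow> 0 < n \<Longrightarrow> 0 \<notin> adj n A"
  by (auto simp: adj_def)

lemma Suc_image_adj: "Suc ` adj n A = adj (Suc n) A"
  by (auto simp: adj_def image_image)

lemma mem_adj: "k \<in> adj n A \<longleftrightarrow> k = n \<or> (n \<le> k \<and> k - n \<in> A)"
  by (auto simp: adj_def image_iff) (metis le_add_diff_inverse)

lemma mk_causal:
  assumes "\<And>t'. t' \<le> t \<Longrightarrow> k t' = k2 t' \<and> d t' = d2 t'"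
    and "\<And>t' i'. i' < m \<Longrightarrow> w * t' + 2 * i' < w * t + 2 * i \<Longrightarrow> c t' ! i' = c2 t' ! i'"
    and "j < w * t + (7 + 2 * i)" "i < m"
  shows "mk k d c j = mk k2 d2 c2 j"
proof -
  obtain t' r where j: "j = w * t' + r" "r < w" by (rule frame_cases)
  have "w * t' < w * Suc t" using j assms(3,4) by (simp add: w_def)
  then have t': "t' \<le> t" by (simp add: w_less_iff less_Suc_eq_le del: mult_Suc_right)
  show ?thesis
  proof (cases "odd r \<and> r \<noteq> 1 \<and> r \<noteq> 3 \<and> r \<noteq> 5")
    case True
    then obtain i' where i': "r = 7 + 2 * i'" "i' < m" using odd_offset j(2) by blast
    then have "w * t' + 2 * i' < w * t + 2 * i" using assms(3) j by simp
    then show ?thesis using assms(2) i' unfolding j i'(1) by (simp only: mk_cell)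
  next
    case False
    then show ?thesis using assms(1)[OF t'] j by (auto simp: mk_at)
  qed
qed

text \<open>An event requires a pulse in its own frame, so none lies before \<open>s\<close>; in
  frame \<open>s\<close> the pulse refutes \<open>fpre\<close>, which forces the event.\<close>

lemma first_pulse:
  assumes "fbody x y z" "\<And>t. t < s \<Longrightarrow> \<not> kap x t \<and> \<not> del x t" "kap x s \<or> del x s"
  shows "fevent x y z s" "t < s \<Longrightarrow> fpre x y t"
proof -
  have ev: "s \<le> u" if "fevent x y z u" for u
    using that assms(2)[of u] by (fastforce simp: fevent_def)
  have all: "fpre x y t \<or> (\<exists>u\<le>t. fevent x y z u)" for t using assms(1) by (simp add: fbody_def)
  show "t < s \<Longrightarrow> fpre x y t" using all[of t] ev by fastforce
  have "\<not> fpre x y s" using assms(3) by (auto simp: fpre_def)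
  then show "fevent x y z s" using all[of s] ev by (metis le_antisym)
qed

end

section \<open>Answers of a correct transducer to K and D inputs\<close>

locale correct = layout +
  fixes F :: "stream \<Rightarrow> stream"
  assumes spec: "fbody x (F x) (F (F x))"
    and causal: "(\<And>j. j < k \<Longrightarrow> u j = v j) \<Longrightarrow> F u k = F v k"
begin

text \<open>The K comes out as a D in the same frame while later pulses are delayed by one, so all
  distances from the start grow by one.\<close>

lemma F_K:
  assumes A: "0 \<notin> A" and y: "y = F (K s A c)"
  shows "y = D s (Suc ` A) (cel y)" "t < s \<Longrightarrow> cel y t = replicate m False"
    "s \<le> t \<Longrightarrow> cel y t = cel (F y) t"
proof -
  let ?x = "K s A c"
  have b: "fbody ?x y (F y)" unfolding y by (rule spec)
  have kx: "kap ?x t \<longleftrightarrow> t = s \<or> (s < t \<and> t - s \<in> A)" and dx: "\<not> del ?x t" for t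
    by (simp_all add: K_def)
  have ev: "fevent ?x y (F y) s" and pr: "\<And>t. t < s \<Longrightarrow> fpre ?x y t"
    using first_pulse[OF b, of s] kx dx by auto
  show "t < s \<Longrightarrow> cel y t = replicate m False" using pr by (simp add: fpre_def)
  show "s \<le> t \<Longrightarrow> cel y t = cel (F y) t" using ev kx by (auto simp: fevent_def)
  show "y = D s (Suc ` A) (cel y)"
    unfolding D_def
  proof (rule clock_mk)
    show "clock y 0" using b by (simp add: fbody_def)
    show "(\<lambda>t. s < t \<and> t - s \<in> Suc ` A) = kap y"
    proof
      fix t
      \<comment> \<open>The slot at offset 3 of frame \<open>t\<close> is decided in frame
        \<open>t - 1\<close>: silent before the event, explicitly false right after it, relayed
        later.\<close>
      consider "t = 0" | u where "t = Suc u" "u < s" | "t = Suc s" | u where "t = Suc u" "s < u"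
        by (cases t) (auto simp: not_less_eq less_Suc_eq intro: linorder_cases)
      then show "(s < t \<and> t - s \<in> Suc ` A) = kap y t"
      proof cases
        case 1
        then show ?thesis using b by (simp add: fbody_def)
      next
        case 2
        then show ?thesis using pr[of u] by (simp add: fpre_def)
      next
        case 3
        then show ?thesis using ev A by (auto simp: fevent_def)
      next
        case 4
        then have "kap y t = kap ?x u" using ev by (simp add: fevent_def)
        then show ?thesis using 4 by (auto simp: kx Suc_diff_le)
      qed
    qed
    show "(\<lambda>t. t = s) = del y"
    proof
      fix t
      show "(t = s) = del y t"
        using pr[of t] ev kx by (cases t s rule: linorder_cases) (auto simp: fpre_def fevent_def)
    qed
  qed
qed

text \<open>The D is dropped, and the pulse at distance \<open>e\<close> becomes the first one, a K
  one frame later. The pulses behind it are delayed equally and keep their distances to it.\<close>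

lemma F_D:
  assumes A: "0 \<notin> A" and e: "1 \<le> e" and y: "y = F (D s (adj e A) c)"
  shows "y = K (s + e + 1) A (cel y)"
    "e = 2 \<Longrightarrow> s \<le> t \<Longrightarrow> cel y t = cel (F y) (t + 3)"
    "e = 3 \<Longrightarrow> s \<le> t \<Longrightarrow> cel y t = cel (F y) (t + 4)"
    "cel y (s + e + 1) ! 1 \<Longrightarrow> s + e < u \<Longrightarrow> V (cel y u) (cel y (Suc u)) (cel (F y) u) (cel (F y) (Suc u))"
proof -
  let ?x = "D s (adj e A) c"
  have b: "fbody ?x y (F y)" unfolding y by (rule spec)
  have kx: "kap ?x t \<longleftrightarrow> s < t \<and> t - s \<in> adj e A" and dx: "del ?x t \<longleftrightarrow> t = s" for t
    by (simp_all add: D_def)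
  have kx': "kap ?x t \<longleftrightarrow> t = s + e \<or> (s + e < t \<and> t - (s + e) \<in> A)" for t
    unfolding kx mem_adj using A e by (auto simp: less_diff_conv intro!: gr0I)
  have ev: "fevent ?x y (F y) s" and pr: "\<And>t. t < s \<Longrightarrow> fpre ?x y t"
    using first_pulse[OF b, of s] kx dx by auto
  have nk: "\<not> kap ?x t" if "t < s + e" for t using that kx' by auto
  have ke: "kap ?x (s + e)" using kx' by simp
  show "cel y t = cel (F y) (t + 3)" if "e = 2" "s \<le> t"
    using ev nk[of s] nk[of "s + 1"] ke that e by (auto simp: fevent_def)
  show "cel y t = cel (F y) (t + 4)" if "e = 3" "s \<le> t"
    using ev nk[of s] nk[of "s + 1"] nk[of "s + 2"] ke that e by (auto simp: fevent_def)
  show "V (cel y u) (cel y (Suc u)) (cel (F y) u) (cel (F y) (Suc u))"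
    if "cel y (s + e + 1) ! 1" "s + e < u"
  proof -
    have "\<not> kap ?x s" using nk e by simp
    with ev have "\<forall>e>s. kap ?x e \<and> cel y (Suc e) ! 1 \<and> (\<forall>u. s < u \<and> u < e \<longrightarrow> \<not> kap ?x u) \<longrightarrow>
        (\<forall>u>e. V (cel y u) (cel y (Suc u)) (cel (F y) u) (cel (F y) (Suc u)))"
      by (simp add: fevent_def)
    moreover have "s < s + e" "\<forall>u. s < u \<and> u < s + e \<longrightarrow> \<not> kap ?x u" using e nk by auto
    moreover have "cel y (Suc (s + e)) ! 1" using that(1) by simp
    ultimately show ?thesis using ke that(2) by blast
  qed
  show "y = K (s + e + 1) A (cel y)"
    unfolding K_def
  proof (rule clock_mk)
    show "clock y 0" using b by (simp add: fbody_def)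
    show "(\<lambda>t. t = s + e + 1 \<or> (s + e + 1 < t \<and> t - (s + e + 1) \<in> A)) = kap y"
    proof
      fix t
      consider "t = 0" | u where "t = Suc u" "u < s" | "t = Suc s" | u where "t = Suc u" "s < u"
        by (cases t) (auto simp: not_less_eq less_Suc_eq intro: linorder_cases)
      then show "(t = s + e + 1 \<or> (s + e + 1 < t \<and> t - (s + e + 1) \<in> A)) = kap y t"
      proof cases
        case 1
        then show ?thesis using b by (simp add: fbody_def)
      next
        case 2
        then show ?thesis using pr[of u] by (simp add: fpre_def)
      next
        case 3
        then show ?thesis using ev e by (auto simp: fevent_def)
      next
        case 4
        then have "kap y t = kap ?x u" using ev by (simp add: fevent_def)
        then show ?thesis using 4 by (auto simp: kx')
      qed
    qed
    show "(\<lambda>_. False) = del y"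
    proof
      fix t
      show "False = del y t"
        using pr[of t] ev nk[of s] e by (cases t s rule: linorder_cases) (auto simp: fpre_def fevent_def)
    qed
  qed
qed

section \<open>Independence of late plays from start, tail and data\<close>

definition play :: "nat \<Rightarrow> nat set \<Rightarrow> (nat \<Rightarrow> bool list) \<Rightarrow> nat \<Rightarrow> nat \<Rightarrow> bool" where
  "play s A c k i = cel (F (K s A c)) (s + k) ! i"

abbreviation every :: "nat set" where "every \<equiv> {1..}"

text \<open>The reference play. Its input has a pulse in every frame; this full tail reproduces
  itself under hops by 3 frames, which links frame 0 to arbitrarily late starts.\<close>

definition G :: "nat \<Rightarrow> bool list" where
  "G = cel (F (K 0 every (\<lambda>_. [])))"

text \<open>The data that the second process receives once the first has played \<open>G\<close>
  from frame \<open>s\<close>; using it in \<open>dplay\<close> removes the unknown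
  \<open>c\<close>.\<close>

definition hist :: "nat \<Rightarrow> nat \<Rightarrow> bool list" where
  "hist s t = (if t < s then replicate m False else G (t - s))"

definition dplay :: "nat \<Rightarrow> nat set \<Rightarrow> nat \<Rightarrow> nat \<Rightarrow> bool" where
  "dplay s A k i = cel (F (D s A (hist s))) (s + k) ! i"

definition before :: "nat \<Rightarrow> nat \<Rightarrow> nat \<Rightarrow> nat \<Rightarrow> bool" where
  "before k' i' k i = (i' < m \<and> w * k' + 2 * i' < w * k + 2 * i)"

text \<open>The pulses of frame \<open>t\<close> itself must agree, since their slots precede the
  cell; of the data only earlier bits matter.\<close>

lemma F_mk_causal:
  assumes "\<And>t'. t' \<le> t \<Longrightarrow> k t' = k2 t' \<and> d t' = d2 t'"
    and "\<And>t' i'. before t' i' t i \<Longrightarrow> c t' ! i' = c2 t' ! i'" "i < m"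
  shows "cel (F (mk k d c)) t ! i = cel (F (mk k2 d2 c2)) t ! i"
  unfolding nth_cel[OF assms(3)]
  by (rule causal, rule mk_causal[of t _ _ _ _ i]) (use assms in \<open>auto simp: before_def\<close>)

lemma before_shift: "before (s + k') i' (s + k) i \<longleftrightarrow> before k' i' k i"
  by (simp add: before_def algebra_simps)

text \<open>If the play is already known before position \<open>(k, i)\<close>, then so is the input of the second
  process when the first one gets a \<open>K\<close>-start; hence bit \<open>i\<close> of cell \<open>k\<close> cannot
  depend on the data \<open>c\<close> given to the first process.\<close>

lemma play_dplay:
  assumes A: "0 \<notin> A" and i: "i < m"
    and IH: "\<And>k' i'. before k' i' k i \<Longrightarrow> play s A c k' i' = G k' ! i'"
  shows "play s A c k i = dplay s (Suc ` A) k i"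
proof -
  define y where "y = F (K s A c)"
  note FK = F_K[OF A y_def]
  have "play s A c k i = cel (F y) (s + k) ! i" using FK(3) by (simp add: play_def y_def[symmetric])
  also have "\<dots> = cel (F (D s (Suc ` A) (cel y))) (s + k) ! i" using FK(1) by simp
  also have "\<dots> = dplay s (Suc ` A) k i"
    unfolding dplay_def D_def
  proof (rule F_mk_causal)
    fix t' i' assume b: "before t' i' (s + k) i"
    show "cel y t' ! i' = hist s t' ! i'"
    proof (cases "t' < s")
      case False
      then obtain k' where t': "t' = s + k'" by (metis le_add_diff_inverse not_le)
      then show ?thesis using IH[of k' i'] b by (simp add: before_shift hist_def play_def y_def)
    qed (simp add: FK(2) hist_def)
  qed (simp_all add: i)
  finally show ?thesis .
qed

text \<open>The lag conditions equate the play of the first process with that of the second, which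
  gets a K-start \<open>e + 1\<close> frames later. The data \<open>c\<close> is the play of the
  first process.\<close>

lemma dplay_play:
  assumes A: "0 \<notin> A" and e: "e = 2 \<or> e = 3" and i: "i < m"
  obtains c where "dplay s (adj e A) k i = play (s + e + 1) A c k i"
proof -
  define y where "y = F (D s (adj e A) (hist s))"
  have e1: "1 \<le> e" using e by auto
  note FD = F_D[OF A e1 y_def]
  have "cel y (s + k) = cel (F y) (s + k + (e + 1))" using FD(2,3)[of "s + k"] e by (auto simp: eval_nat_numeral)
  then have "dplay s (adj e A) k i = cel (F (K (s + e + 1) A (cel y))) (s + e + 1 + k) ! i"
    using FD(1) by (simp add: dplay_def y_def[symmetric] add_ac)
  then show ?thesis by (intro that) (simp add: play_def)
qed

lemma dplay_cong:
  assumes "\<And>a. a \<le> k \<Longrightarrow> a \<in> A \<longleftrightarrow> a \<in> B" "i < m"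
  shows "dplay s A k i = dplay s B k i"
  unfolding dplay_def D_def by (rule F_mk_causal) (use assms in auto)

lemma adj_every: "adj 1 every = every"
  by (auto simp: mem_adj)

lemma adj_pow_not0: "0 \<notin> A \<Longrightarrow> 0 < n \<Longrightarrow> 0 \<notin> (adj n ^^ j) A"
  by (induction j) (simp_all add: adj_not0)

lemma mem_adj_pow: "1 \<le> a \<Longrightarrow> a \<le> j \<Longrightarrow> a \<in> (adj 1 ^^ j) A"
proof (induction j arbitrary: a)
  case (Suc j)
  then show ?case by (cases "a = 1") (simp_all add: mem_adj)
qed simp

text \<open>The first clause is the goal, for late starts only. The second reaches down to frame 0,
  where \<open>G\<close> is defined, and so identifies the common late play with
  \<open>G\<close>.\<close>

definition settled :: "nat \<Rightarrow> nat \<Rightarrow> bool" where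
  "settled k i = ((\<forall>\<^sub>F s in sequentially. \<forall>A c. 0 \<notin> A \<longrightarrow> play s A c k i = G k ! i) \<and>
     (\<forall>a c. play (3 * a) every c k i = G k ! i))"

text \<open>Prefixing a tail of pulses by pulses in the next \<open>j\<close> frames amounts to shifting the
  start by \<open>3 * j\<close> frames; by causality the original tail is then invisible up to cell \<open>j\<close>.
  Steps of length 4 adjust the start modulo 3.\<close>

lemma settled_step:
  assumes i: "i < m" and IH: "\<And>k' i'. before k' i' k i \<Longrightarrow> settled k' i'"
  shows "settled k i"
proof -
  \<comment> \<open>Finitely many bits precede position \<open>(k, i)\<close>, so a single bound
    \<open>B\<close> serves all of them.\<close>
  have fin: "finite {(k', i'). before k' i' k i}"
  proof (rule finite_subset)
    show "{(k', i'). before k' i' k i} \<subseteq> {..w * k + 2 * i} \<times> {..<m}"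
    proof clarsimp
      fix k' i' assume "before k' i' k i"
      then have "w * k' \<le> w * k + 2 * i" "i' < m" by (auto simp: before_def)
      moreover have "k' \<le> w * k'" using w_pos by simp
      ultimately show "k' \<le> w * k + 2 * i \<and> i' < m" by linarith
    qed
  qed simp
  have "\<forall>\<^sub>F s in sequentially. \<forall>p\<in>{(k', i'). before k' i' k i}.
      \<forall>A c. 0 \<notin> A \<longrightarrow> play s A c (fst p) (snd p) = G (fst p) ! snd p"
    by (rule eventually_ball_finite[OF fin]) (use IH in \<open>auto simp: settled_def\<close>)
  then obtain B where B0: "\<forall>s\<ge>B. \<forall>p\<in>{(k', i'). before k' i' k i}.
      \<forall>A c. 0 \<notin> A \<longrightarrow> play s A c (fst p) (snd p) = G (fst p) ! snd p"
    unfolding eventually_sequentially by blast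
  have B: "play s A c k' i' = G k' ! i'" if "B \<le> s" "0 \<notin> A" "before k' i' k i" for s A c k' i'
    using B0[rule_format, of s "(k', i')" A c] that by simp
  have pd: "play s A c k i = dplay s (Suc ` A) k i" if "B \<le> s" "0 \<notin> A" for s A c
    using that by (intro play_dplay i B)
  have pd': "play (3 * a) every c k i = dplay (3 * a) (Suc ` every) k i" for a c
    using IH by (intro play_dplay i) (auto simp: settled_def)
  \<comment> \<open>With \<open>e = Suc n\<close> the start moves by \<open>e + 1 = n + 2\<close>
    frames: 3 for \<open>n = 1\<close> and 4 for \<open>n = 2\<close>. The leading pulse of the tail
    is consumed.\<close>
  have hop: "dplay s (Suc ` adj n A) k i = dplay (s + n + 2) (Suc ` A) k i"
    if h: "B \<le> s" "0 \<notin> A" "n = 1 \<or> n = 2" for s A n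
  proof -
    have "Suc n = 2 \<or> Suc n = 3" using h(3) by auto
    then obtain c where "dplay s (adj (Suc n) A) k i = play (s + Suc n + 1) A c k i"
      using dplay_play[OF h(2) _ i] by blast
    then show ?thesis using pd[of "s + Suc n + 1" A c] h by (simp add: Suc_image_adj)
  qed
  have hops: "dplay s (Suc ` (adj n ^^ j) A) k i = dplay (s + (n + 2) * j) (Suc ` A) k i"
    if "B \<le> s" "0 \<notin> A" "n = 1 \<or> n = 2" for s A n j
    using that(2)
  proof (induction j arbitrary: A)
    case (Suc j)
    have "dplay s (Suc ` (adj n ^^ Suc j) A) k i = dplay (s + (n + 2) * j) (Suc ` adj n A) k i"
      using Suc.IH[of "adj n A"] Suc.prems that(3) adj_not0[of A n]
      by (simp only: funpow_Suc_right o_apply) auto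
    also have "\<dots> = dplay (s + (n + 2) * j + n + 2) (Suc ` A) k i"
      using that Suc.prems by (intro hop) auto
    finally show ?case by (simp add: algebra_simps)
  qed simp
  have every: "dplay (3 * a) (Suc ` every) k i = G k ! i" for a
  proof (induction a)
    case 0
    show ?case using pd'[of 0 "\<lambda>_. []"] by (simp add: play_def G_def)
  next
    case (Suc a)
    obtain c where "dplay (3 * a) (adj 2 every) k i = play (3 * a + 2 + 1) every c k i"
      by (rule dplay_play[of every 2, OF _ _ i]) auto
    moreover have "adj 2 every = Suc ` every"
      using Suc_image_adj[of 1 every] adj_every by (simp add: numeral_2_eq_2)
    moreover have "3 * a + 2 + 1 = 3 * Suc a" by simp
    ultimately show ?case using Suc pd'[of "Suc a" c] by metis
  qed
  have "play s A c k i = G k ! i" if s: "3 * B + 3 * k + 20 \<le> s" and A: "0 \<notin> A" for s A c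
  proof -
    \<comment> \<open>\<open>s\<close> becomes \<open>3 * B + 3 * j + 4 * b\<close>: hops of length
      4 absorb its residue modulo 3. The slack in the bound on \<open>s\<close> prevents truncation
      in \<open>j\<close> and gives \<open>k \<le> j\<close>.\<close>
    define b where "b = s mod 3"
    define j where "j = s div 3 - B - b"
    have b: "b < 3" by (simp add: b_def)
    have "s = 3 * (s div 3) + b" by (simp add: b_def)
    then have sj: "s = 3 * B + 3 * j + 4 * b" using s b unfolding j_def by linarith
    have kj: "k \<le> j" using sj s b by simp
    let ?A = "(adj 2 ^^ b) A"
    have A': "0 \<notin> ?A" using A by (rule adj_pow_not0) simp
    have "play s A c k i = dplay s (Suc ` A) k i" using s A by (intro pd) auto
    also have "\<dots> = dplay (3 * B + 3 * j) (Suc ` ?A) k i"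
      using hops[of "3 * B + 3 * j" A 2 b] A by (simp add: sj)
    also have "\<dots> = dplay (3 * B) (Suc ` (adj 1 ^^ j) ?A) k i"
      using hops[of "3 * B" ?A 1 j] A' by (simp add: add.commute)
    also have "\<dots> = dplay (3 * B) (Suc ` every) k i"
    proof (rule dplay_cong[OF _ i])
      fix a assume a: "a \<le> k"
      have "0 \<notin> (adj 1 ^^ j) ?A" using A' by (rule adj_pow_not0) simp
      then have "n \<in> (adj 1 ^^ j) ?A \<longleftrightarrow> n \<in> every" if "n \<le> j" for n
        using mem_adj_pow[of n j ?A] that by (cases "n = 0") auto
      then show "a \<in> Suc ` (adj 1 ^^ j) ?A \<longleftrightarrow> a \<in> Suc ` every"
        using a kj by (cases a) (auto simp del: atLeast_iff)
    qed
    also have "\<dots> = G k ! i" by (rule every)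
    finally show ?thesis .
  qed
  moreover have "play (3 * a) every c k i = G k ! i" for a c
    using pd' every by simp
  ultimately show ?thesis
    unfolding settled_def eventually_sequentially by blast
qed

lemma settled: "i < m \<Longrightarrow> settled k i"
proof (induction "w * k + 2 * i" arbitrary: k i rule: less_induct)
  case less
  show ?case
  proof (rule settled_step[OF less.prems])
    fix k' i' assume "before k' i' k i"
    then show "settled k' i'" by (intro less.hyps) (simp_all add: before_def)
  qed
qed

lemma play_eventually: "\<exists>B. \<forall>s\<ge>B. \<forall>A c. 0 \<notin> A \<longrightarrow> (\<forall>k<N. cel (F (K s A c)) (s + k) = G k)"
proof -
  have "\<forall>\<^sub>F s in sequentially. \<forall>p\<in>{..<N} \<times> {..<m}. \<forall>A c. 0 \<notin> A \<longrightarrow> play s A c (fst p) (snd p) = G (fst p) ! snd p"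
    by (rule eventually_ball_finite) (use settled in \<open>auto simp: settled_def\<close>)
  then obtain B where "\<forall>s\<ge>B. \<forall>p\<in>{..<N} \<times> {..<m}. \<forall>A c. 0 \<notin> A \<longrightarrow> play s A c (fst p) (snd p) = G (fst p) ! snd p"
    unfolding eventually_sequentially by blast
  then have "\<forall>s\<ge>B. \<forall>A c. 0 \<notin> A \<longrightarrow> (\<forall>k<N. cel (F (K s A c)) (s + k) = G k)"
    by (auto simp: list_eq_iff_nth_eq play_def G_def)
  then show ?thesis by blast
qed

text \<open>After a late D followed by a single pulse \<open>L - 1\<close> frames later, the first
  process plays \<open>G\<close> from frame \<open>B\<close> and the second, started one frame after
  the pulse, from frame \<open>B + L\<close>. The flag of cell \<open>L\<close> triggers the row
  condition of \<open>event\<close>.\<close>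

lemma G_vertical:
  assumes L: "3 \<le> L" "G L ! 1"
  shows "V (G (L + k)) (G (Suc (L + k))) (G k) (G (Suc k))"
proof -
  define N where "N = L + k + 2"
  obtain B where B0: "\<forall>s\<ge>B. \<forall>A c. 0 \<notin> A \<longrightarrow> (\<forall>k<N. cel (F (K s A c)) (s + k) = G k)"
    using play_eventually[of N] ..
  have B: "cel (F (K s A c)) (s + k) = G k" if "B \<le> s" "0 \<notin> A" "k < N" for s A c k
    using B0 that by simp
  define y where "y = F (D B (adj (L - 1) {}) (hist B))"
  note FD = F_D[of "{}" "L - 1", OF _ _ y_def]
  have y: "cel y (B + k) = G k" if k: "k < N" for k
  proof (rule nth_equalityI)
    fix i assume "i < length (cel y (B + k))"
    then have i: "i < m" by simp
    \<comment> \<open>The tail \<open>{L - 2}\<close> of a K-start is relayed as the tail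
      \<open>{L - 1}\<close>; \<open>3 \<le> L\<close> keeps 0 out of the former, as
      \<open>play_dplay\<close> demands.\<close>
    have A: "0 \<notin> {L - 2}" "Suc ` {L - 2} = adj (L - 1) {}" using L by (auto simp: adj_def)
    have "play B {L - 2} c k' i' = G k' ! i'" if "k' < N" for c k' i'
      using B[OF order_refl A(1) that] by (simp add: play_def)
    moreover have "k' < N" if "before k' i' k i" for k' i'
    proof -
      have "w * k' < w * Suc k" using that i by (simp add: before_def w_def)
      then show ?thesis using k by (simp only: w_less_iff)
    qed
    ultimately have "play B {L - 2} (\<lambda>_. []) k i = dplay B (Suc ` {L - 2}) k i"
      by (intro play_dplay A i) auto
    then show "cel y (B + k) ! i = G k ! i"
      using B[OF order_refl A(1) k, of "\<lambda>_. []"] A(2) by (simp add: play_def dplay_def y_def)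
  qed (simp add: G_def)
  have z: "cel (F y) (B + L + k) = G k" if "k < N" for k
  proof -
    have "y = K (B + L) {} (cel y)" using FD(1) L by simp
    then show ?thesis using B[of "B + L" "{}" k "cel y"] that by simp
  qed
  have "cel y (B + L) ! 1" using y[of L] L by (simp add: N_def)
  then have "V (cel y (B + L + k)) (cel y (Suc (B + L + k))) (cel (F y) (B + L + k)) (cel (F y) (Suc (B + L + k)))"
    using FD(4)[of "B + L + k"] L by simp
  moreover have "cel y (B + L + k) = G (L + k)" "cel y (Suc (B + L + k)) = G (Suc (L + k))"
    using y[of "L + k"] y[of "Suc (L + k)"] by (simp_all add: N_def add.assoc)
  moreover have "cel (F y) (B + L + k) = G k" "cel (F y) (Suc (B + L + k)) = G (Suc k)"
    using z[of k] z[of "Suc k"] by (simp_all add: N_def)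
  ultimately show ?thesis by simp
qed

lemma sound:
  obtains x where "clock (F x) 0" "kap x 0" "fhoriz (cel (F x))"
    "\<And>L k. cel (F x) L ! 1 \<Longrightarrow> V (cel (F x) (L + k)) (cel (F x) (Suc (L + k))) (cel (F x) k) (cel (F x) (Suc k))"
proof -
  let ?x = "K 0 every (\<lambda>_. [])"
  have x: "kap ?x 0" by (simp add: K_def)
  then have h: "clock (F ?x) 0" "fhoriz (cel (F ?x))" using spec[of ?x] by (simp_all add: fbody_def)
  then have "3 \<le> L" if "cel (F ?x) L ! 1" for L using that by (meson fhoriz_def not_le)
  then show ?thesis using G_vertical by (intro that[of ?x] x h) (auto simp: G_def)
qed

end

section \<open>The intended machine\<close>

context layout
begin

lemma clock_mk_intro: "clock (mk k d c) 0"
proof -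
  let ?y = "mk k d c"
  have frame: "H ?y (w * t)" "\<forall>l\<in>{1..m+3}. \<not> ?y (w * t + 2 * l)" for t
  proof -
    have "?y (w * t + 0)" "?y (w * t + 1)" by (subst mk_at; simp add: w_def)+
    then show "H ?y (w * t)" by (simp add: H_def)
    show "\<forall>l\<in>{1..m+3}. \<not> ?y (w * t + 2 * l)"
    proof
      fix l assume l: "l \<in> {1..m+3}"
      then have "2 * l \<noteq> 3" "2 * l \<noteq> 5" by presburger+
      with l show "\<not> ?y (w * t + 2 * l)" by (subst mk_at) (auto simp: w_def)
    qed
  qed
  have "\<exists>t. i = w * t" if h: "H ?y i" for i
  proof -
    obtain t r where i: "i = w * t + r" "r < w" by (rule frame_cases)
    have "r = 0"
    proof (rule ccontr)
      assume r: "r \<noteq> 0"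
      define l where "l = (r + 1) div 2"
      have l: "2 * l = r \<or> 2 * l = r + 1" by (auto simp: l_def)
      then have "l \<in> {1..m+3}" using r i(2) by (auto simp: w_def)
      then have "\<not> ?y (w * t + 2 * l)" using frame(2) by blast
      then show False using l h by (auto simp: H_def i(1))
    qed
    then show ?thesis using i by simp
  qed
  moreover have "w * t + w = w * Suc t" for t by simp
  ultimately show ?thesis
    unfolding clock_def using frame frame(1)[of 0] by (metis mult_0_right)
qed

section \<open>A transducer that meets the specification\<close>

definition pulse :: "stream \<Rightarrow> nat \<Rightarrow> bool" where
  "pulse x t = (kap x t \<or> del x t)"

definition started :: "stream \<Rightarrow> nat \<Rightarrow> bool" where
  "started x t = (\<exists>u<t. pulse x u)"

text \<open>\<open>started\<close> counts strictly earlier frames, so the first pulse itself is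
  never relayed at offset 3. The cell uses \<open>started x (Suc t)\<close> because the slots of
  frame \<open>t\<close> precede it and the play begins in the frame of the pulse.\<close>

definition honest :: "(nat \<Rightarrow> bool list) \<Rightarrow> stream \<Rightarrow> stream" where
  "honest G x = mk (\<lambda>t. 0 < t \<and> kap x (t - 1) \<and> started x (t - 1)) (\<lambda>t. kap x t \<and> \<not> started x t)
     (\<lambda>t. if started x (Suc t) then G (t - (LEAST u. pulse x u)) else replicate m False)"

lemma first_pulse_cases:
  obtains "\<forall>t. \<not> pulse x t" | s where "pulse x s" "\<forall>t<s. \<not> pulse x t"
proof (cases "\<exists>s. pulse x s")
  case True
  then show ?thesis using that(2) by (metis LeastI_ex not_less_Least)
next
  case False
  then show ?thesis using that(1) by blast
qed

lemma started_iff: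
  assumes "pulse x s" "\<And>t. t < s \<Longrightarrow> \<not> pulse x t"
  shows "started x t \<longleftrightarrow> s < t" "(LEAST u. pulse x u) = s"
proof -
  show "started x t \<longleftrightarrow> s < t" unfolding started_def using assms by (metis linorder_neqE_nat less_trans)
  show "(LEAST u. pulse x u) = s" using assms by (intro Least_equality) (auto simp: not_less[symmetric])
qed

lemma cel_mk: "length (c t) = m \<Longrightarrow> cel (mk k d c) t = c t"
  by (rule nth_equalityI) (simp_all add: nth_cel mk_cell del: add_Suc)

context
  fixes G :: "nat \<Rightarrow> bool list"
  assumes len: "\<And>k. length (G k) = m"
begin

lemma cel_honest:
  assumes "pulse x s" "\<And>t. t < s \<Longrightarrow> \<not> pulse x t"
  shows "cel (honest G x) t = (if s \<le> t then G (t - s) else replicate m False)"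
proof -
  note st = started_iff[OF assms]
  show ?thesis unfolding honest_def by (subst cel_mk) (simp_all add: st len)
qed

lemma kap_honest: "kap (honest G x) t \<longleftrightarrow> 0 < t \<and> kap x (t - 1) \<and> started x (t - 1)"
  and del_honest: "del (honest G x) t \<longleftrightarrow> kap x t \<and> \<not> started x t"
  by (simp_all add: honest_def)

lemma honest_K:
  assumes "kap x s" "\<And>t. t < s \<Longrightarrow> \<not> pulse x t" "s \<le> t"
  shows "cel (honest G (honest G x)) t = G (t - s)"
proof -
  have s: "pulse x s" using assms(1) by (simp add: pulse_def)
  note st = started_iff[OF s assms(2)]
  have "pulse (honest G x) s" using assms(1) st by (simp add: pulse_def del_honest)
  moreover have "\<not> pulse (honest G x) t" if "t < s" for t
    using assms(2)[of t] that st(1)[of "t - 1"] by (simp add: pulse_def del_honest kap_honest) linarith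
  ultimately show ?thesis using cel_honest assms(3) by simp
qed

lemma honest_D:
  assumes "\<not> kap x s" "pulse x s" "\<And>t. t < s \<Longrightarrow> \<not> pulse x t"
    and e: "s < e" "kap x e" "\<And>u. s < u \<Longrightarrow> u < e \<Longrightarrow> \<not> kap x u" and t: "e < t"
  shows "cel (honest G (honest G x)) t = G (t - Suc e)"
proof -
  note st = started_iff[OF assms(2,3)]
  have nd: "\<not> del (honest G x) t" for t
    using assms(1) assms(3)[of t] st by (cases t s rule: linorder_cases) (auto simp: del_honest pulse_def)
  have "pulse (honest G x) (Suc e)" using e st by (simp add: pulse_def kap_honest)
  moreover have "\<not> pulse (honest G x) t" if "t < Suc e" for t
  proof -
    have "t - 1 < e" using that e(1) by linarith
    then show ?thesis using e(3)[of "t - 1"] st(1)[of "t - 1"] nd[of t] by (auto simp: pulse_def kap_honest)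
  qed
  ultimately show ?thesis using cel_honest t by simp
qed

lemma honest_fbody:
  assumes G: "fhoriz G" and V: "\<And>L k. G L ! 1 \<Longrightarrow> V (G (L + k)) (G (Suc (L + k))) (G k) (G (Suc k))"
  shows "fbody x (honest G x) (honest G (honest G x))"
proof -
  let ?y = "honest G x"
  let ?z = "honest G ?y"
  have c: "clock ?y 0" unfolding honest_def by (rule clock_mk_intro)
  have k0: "\<not> kap ?y 0" by (simp add: kap_honest)
  show ?thesis
  proof (cases rule: first_pulse_cases[of x])
    case 1
    have 1: "\<not> pulse x t" for t using 1 by blast
    then have ns: "\<not> started x t" for t by (simp add: started_def)
    have "cel ?y t = replicate m False" for t
      unfolding honest_def by (subst cel_mk) (simp_all add: ns)
    then have "fpre x ?y t" for t using 1[of t] ns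
      by (auto simp: fpre_def pulse_def kap_honest del_honest)
    then show ?thesis using c k0 1[of 0] by (simp add: fbody_def pulse_def)
  next
    case (2 s)
    have "\<not> pulse x t" if "t < s" for t using that 2(2) by blast
    note 2 = 2(1) this
    note st = started_iff[OF 2]
    note ce = cel_honest[OF 2]
    have pr: "fpre x ?y t" if "t < s" for t
      using 2(2)[OF that] that by (simp add: fpre_def pulse_def kap_honest del_honest ce)
    have D: "cel ?z u = G (u - Suc e)"
      if "\<not> kap x s" "s < e" "kap x e" "\<forall>u. s < u \<and> u < e \<longrightarrow> \<not> kap x u" "e < u" for e u
      using honest_D[of x s e u] 2 that by blast
    have ev: "fevent x ?y ?z s"
      unfolding fevent_def
    proof (intro conjI impI allI)
      show "kap x s \<or> del x s" using 2 by (simp add: pulse_def)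
      show "del ?y s = kap x s" "\<not> kap ?y (Suc s)" by (simp_all add: del_honest kap_honest st)
      show "cel ?y u = cel ?z u" if "kap x s" "s \<le> u" for u
        using that honest_K[OF that(1) 2(2)] by (simp add: ce)
      show "cel ?y u = cel ?z (u + 3)"
        if "\<not> kap x s \<and> \<not> kap x (s + 1) \<and> kap x (s + 2)" "s \<le> u" for u
      proof -
        have "cel ?z (u + 3) = G (u + 3 - Suc (s + 2))"
        proof (rule D)
          show "\<forall>u. s < u \<and> u < s + 2 \<longrightarrow> \<not> kap x u"
            using that(1) by (auto simp: less_Suc_eq numeral_2_eq_2)
        qed (use that in auto)
        then show ?thesis using that(2) by (simp add: ce)
      qed
      show "cel ?y u = cel ?z (u + 4)"
        if "\<not> kap x s \<and> \<not> kap x (s + 1) \<and> \<not> kap x (s + 2) \<and> kap x (s + 3)" "s \<le> u" for u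
      proof -
        have "cel ?z (u + 4) = G (u + 4 - Suc (s + 3))"
        proof (rule D)
          show "\<forall>u. s < u \<and> u < s + 3 \<longrightarrow> \<not> kap x u"
            using that(1) by (auto simp: less_Suc_eq numeral_3_eq_3 numeral_2_eq_2)
        qed (use that in auto)
        then show ?thesis using that(2) by (simp add: ce)
      qed
      show "V (cel ?y u) (cel ?y (Suc u)) (cel ?z u) (cel ?z (Suc u))"
        if h: "\<not> kap x s" "s < e" "kap x e \<and> cel ?y (Suc e) ! 1 \<and> (\<forall>u. s < u \<and> u < e \<longrightarrow> \<not> kap x u)" "e < u"
        for e u
      proof -
        have z: "cel ?z v = G (v - Suc e)" if "e < v" for v using D[of e v] h that by blast
        \<comment> \<open>\<open>Suc e - s\<close> takes the role of the row length: from here on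
          \<open>y\<close> is exactly that many cells ahead of \<open>z\<close>.\<close>
        have "G (Suc e - s) ! 1" using h by (simp add: ce)
        then have "V (G (Suc e - s + (u - Suc e))) (G (Suc (Suc e - s + (u - Suc e)))) (G (u - Suc e)) (G (Suc (u - Suc e)))"
          by (rule V)
        moreover have "Suc e - s + (u - Suc e) = u - s" "Suc (u - s) = Suc u - s" "Suc (u - Suc e) = Suc u - Suc e"
          using h by auto
        ultimately show ?thesis using z[of u] z[of "Suc u"] h by (simp add: ce)
      qed
    qed (auto simp: del_honest kap_honest st)
    have "fhoriz (cel ?y)" if "kap x 0"
    proof -
      have "s = 0" using 2(2)[of 0] that by (auto simp: pulse_def)
      then have "cel ?y = G" using ce by auto
      then show ?thesis using G by simp
    qed
    moreover have "fpre x ?y t \<or> (\<exists>u\<le>t. fevent x ?y ?z u)" for t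
      using pr ev by (cases "t < s") auto
    ultimately show ?thesis using c k0 by (simp add: fbody_def)
  qed
qed

section \<open>A finite machine for an eventually periodic play\<close>

context
  fixes p q :: nat
  assumes q: "0 < q" and per: "\<And>k. p \<le> k \<Longrightarrow> G (k + q) = G k"
begin

definition nxt :: "nat \<Rightarrow> nat" where "nxt i = (if Suc i < p + q then Suc i else p)"

definition idx :: "nat \<Rightarrow> nat" where "idx n = (nxt ^^ n) 0"

lemma idx_Suc: "idx 0 = 0" "idx (Suc n) = nxt (idx n)"
  by (simp_all add: idx_def)

lemma idx_less: "idx n < p + q"
  by (induction n) (auto simp: idx_Suc nxt_def q)

lemma G_idx: "G (idx n + j) = G (n + j)"
proof (induction n arbitrary: j)
  case (Suc n)
  have "G (nxt (idx n) + j) = G (Suc (idx n) + j)"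
  proof (cases "Suc (idx n) < p + q")
    case False
    then have "Suc (idx n) = p + q" using idx_less[of n] by simp
    moreover have "G (p + j + q) = G (p + j)" by (rule per) simp
    ultimately show ?thesis using False by (simp add: nxt_def add_ac)
  qed (simp add: nxt_def)
  then show ?case using Suc[of "Suc j"] by (simp add: idx_Suc)
qed (simp add: idx_def)

type_synonym state = "nat \<times> nat \<times> bool \<times> bool \<times> bool"

text \<open>A state consists of the offset in the frame, the play position (0 before the start,
  else one more than the index of the current cell), the \<open>\<kappa>\<close> bit of this frame, the
  \<open>\<kappa>\<close> bit of the next frame and the \<open>\<delta>\<close> bit of this frame.\<close>

definition trans :: "state \<Rightarrow> bool \<Rightarrow> state" where
  "trans = (\<lambda>(j, st, kb, nk, db) a.
     if j = 3 then (if st = 0 then (4, if a then 1 else 0, kb, False, a) else (4, st, kb, a, db))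
     else if j = 5 then (6, if st = 0 \<and> a then 1 else st, kb, nk, db)
     else if j = w - 1 then (0, if st = 0 then 0 else Suc (nxt (st - 1)), nk, False, False)
     else (Suc j, st, kb, nk, db))"

definition out :: "state \<Rightarrow> bool" where
  "out = (\<lambda>(j, st, kb, nk, db). if j \<le> 1 then True else if j = 3 then kb else if j = 5 then db
     else odd j \<and> (if st = 0 then replicate m False else G (st - 1)) ! ((j - 7) div 2))"

definition machine :: "(state, inp, outp) moore" where
  "machine = \<lparr>delta = \<lambda>s I. trans s (PropA \<in> I), init = (0, 0, False, False, False),
     lab = \<lambda>s. if out s then {PropB} else {}\<rparr>"

lemma finite_machine: "finite_moore machine"
proof -
  let ?Q = "{..<w} \<times> {..p + q} \<times> (UNIV :: bool set) \<times> (UNIV :: bool set) \<times> (UNIV :: bool set)"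
  have w: "6 < w" using m2 by (simp add: w_def)
  have nx: "nxt i < p + q" for i using q by (auto simp: nxt_def)
  have "trans s a \<in> ?Q" if "s \<in> ?Q" for s a
  proof -
    obtain j st kb nk db where s: "s = (j, st, kb, nk, db)" by (cases s) auto
    then show ?thesis using that w q nx[of "st - 1"] by (auto simp: trans_def Suc_le_eq)
  qed
  then show ?thesis
    unfolding finite_moore_def using w by (intro exI[of _ ?Q]) (auto simp: machine_def)
qed

lemma mrun_machine: "mrun machine x 0 = (0, 0, False, False, False)"
  "mrun machine x (Suc k) = trans (mrun machine x k) (x k)"
  by (simp_all add: machine_def)

definition pos :: "stream \<Rightarrow> nat \<Rightarrow> nat" where
  "pos x t = (if started x t then Suc (idx (t - (LEAST u. pulse x u))) else 0)"

lemma pos_eq: "pos x t = 0 \<longleftrightarrow> \<not> started x t"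
  by (simp add: pos_def)

lemma started_Suc: "started x (Suc t) \<longleftrightarrow> started x t \<or> pulse x t"
  by (auto simp: started_def less_Suc_eq)

text \<open>A pulse starts the play in the middle of its frame; \<open>pos\<close> is the play
  position at the beginning of the frame and \<open>mid\<close> the one after both slots.\<close>

definition mid :: "stream \<Rightarrow> nat \<Rightarrow> nat" where
  "mid x t = (if started x (Suc t) then Suc (idx (t - (LEAST u. pulse x u))) else 0)"

lemma mid_step: "(if pos x t = 0 \<and> pulse x t then 1 else pos x t) = mid x t"
proof (cases "pos x t = 0 \<and> pulse x t")
  case True
  then have "pulse x t" "\<And>u. u < t \<Longrightarrow> \<not> pulse x u" by (auto simp: pos_eq started_def)
  then have "(LEAST u. pulse x u) = t" using started_iff(2) by blast
  then show ?thesis using True by (simp add: mid_def started_Suc idx_Suc)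
next
  case False
  then show ?thesis by (auto simp: mid_def pos_def started_Suc)
qed

lemma pos_Suc: "(if mid x t = 0 then 0 else Suc (nxt (mid x t - 1))) = pos x (Suc t)"
proof (cases "started x (Suc t)")
  case True
  then obtain u where "pulse x u" "u \<le> t" by (auto simp: started_def less_Suc_eq_le)
  then have "(LEAST u. pulse x u) \<le> t" by (meson Least_le le_trans)
  then show ?thesis using True by (simp add: mid_def pos_def Suc_diff_le idx_Suc)
qed (simp add: mid_def pos_def)

lemma mrun_frame:
  defines "kb \<equiv> \<lambda>x t. 0 < t \<and> kap x (t - 1) \<and> started x (t - 1)"
  shows "mrun machine x (w * t) = (0, pos x t, kb x t, False, False)" (is "?A t")
    and "j < w \<Longrightarrow> mrun machine x (w * t + j) = (j,
        if j \<le> 3 then pos x t else if j \<le> 5 then (if pos x t = 0 \<and> kap x t then 1 else pos x t) else mid x t,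
        kb x t, 3 < j \<and> kap x t \<and> started x t, 3 < j \<and> kap x t \<and> \<not> started x t)" (is "_ \<Longrightarrow> ?B t j")
proof -
  have w: "11 \<le> w" using m2 by (simp add: w_def)
  have B: "?B t j" if "?A t" "j < w" for t j
    using that(2)
  proof (induction j)
    case 0
    then show ?case using that(1) by simp
  next
    case (Suc j)
    then have IH: "?B t j" by simp
    have st: "mrun machine x (w * t + Suc j) = trans (mrun machine x (w * t + j)) (x (w * t + j))"
      using mrun_machine(2) by simp
    consider "j < 3" | "j = 3" | "j = 4" | "j = 5" | "5 < j" by linarith
    then show ?case
    proof cases
      case 2
      then have "x (w * t + j) = kap x t" by (simp add: kap_def)
      then show ?thesis unfolding st IH using 2 by (auto simp: trans_def pos_eq)
    next
      case 4
      then have "x (w * t + j) = del x t" by (simp add: del_def)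
      then show ?thesis unfolding st IH using 4 mid_step[of x t]
        by (auto simp: trans_def pulse_def split: if_splits)
    qed (unfold st IH, use Suc.prems w in \<open>auto simp: trans_def\<close>)
  qed
  have A: "?A t" for t
  proof (induction t)
    case 0
    show ?case by (simp add: mrun_machine kb_def pos_def started_def del: mrun.simps)
  next
    case (Suc t)
    have eq: "w * Suc t = Suc (w * t + (w - 1))" using w by simp
    have "mrun machine x (w * Suc t) = trans (mrun machine x (w * t + (w - 1))) (x (w * t + (w - 1)))"
      unfolding eq by (rule mrun_machine(2))
    also have "\<dots> = (0, pos x (Suc t), kb x (Suc t), False, False)"
      using B[OF Suc, of "w - 1"] w pos_Suc[of x t] by (auto simp: trans_def kb_def)
    finally show ?case .
  qed
  show "?A t" by (rule A)
  show "j < w \<Longrightarrow> ?B t j" by (rule B[OF A])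
qed

lemma transd_machine: "transd machine = honest G"
proof (intro ext)
  fix x i
  obtain t j where i: "i = w * t + j" "j < w" by (rule frame_cases)
  have "transd machine x i = out (mrun machine x i)"
    by (simp add: transd_def machine_def)
  moreover have "(if mid x t = 0 then replicate m False else G (mid x t - 1)) =
     (if started x (Suc t) then G (t - (LEAST u. pulse x u)) else replicate m False)"
    using G_idx[of _ 0] by (simp add: mid_def)
  ultimately show "transd machine x i = honest G x i"
    unfolding i(1) mrun_frame(2)[OF i(2)] honest_def using i(2)
    by (subst mk_at) (auto simp: out_def elim!: oddE)
qed

end

lemma complete:
  assumes "fhoriz G" "\<And>L k. G L ! 1 \<Longrightarrow> V (G (L + k)) (G (Suc (L + k))) (G k) (G (Suc k))"
    and "0 < q" "\<And>k. p \<le> k \<Longrightarrow> G (k + q) = G k"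
  obtains M :: "(nat, inp, outp) moore" where "finite_moore M"
    "transd M = honest G" "\<And>x. fbody x (transd M x) (transd M (transd M x))"
proof -
  note fm = finite_machine[OF assms(3,4)]
  note tm = transd_machine[OF assms(3,4)]
  obtain M :: "(nat, inp, outp) moore" where M: "finite_moore M" "transd M = transd (machine p q)"
    using fm by (rule finite_moore_nat)
  then have "transd M = honest G" using tm by simp
  then show ?thesis using M(1) honest_fbody[OF assms(1,2)] by (intro that[of M]) simp_all
qed

end

end

section \<open>Tableaux of counter programs\<close>

text \<open>Split off from \<open>step\<close> because control depends on the registers through zero
  tests only, which a cell can record.\<close>

fun next_control :: "cmd list \<Rightarrow> (nat \<Rightarrow> bool) \<Rightarrow> cmd list" where
  "next_control [] nz = []"
| "next_control (Inc r # cs) nz = cs"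
| "next_control (Dec r # cs) nz = cs"
| "next_control (Seq a b # cs) nz = a # b # cs"
| "next_control (Loop r c # cs) nz = (if nz r then c # Loop r c # cs else cs)"

fun update :: "cmd list \<Rightarrow> (nat \<Rightarrow> nat) \<Rightarrow> nat \<Rightarrow> nat" where
  "update (Inc r # cs) s = s(r := Suc (s r))"
| "update (Dec r # cs) s = s(r := s r - 1)"
| "update cs s = s"

lemma step_eq: "step (cs, s) = (next_control cs (\<lambda>r. 0 < s r), update cs s)"
  by (induction "(cs, s)" rule: step.induct) auto

fun regs :: "cmd \<Rightarrow> nat set" where
  "regs (Inc r) = {r}"
| "regs (Dec r) = {r}"
| "regs (Seq a b) = regs a \<union> regs b"
| "regs (Loop r c) = insert r (regs c)"

lemma finite_regs: "finite (regs c)"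
  by (induction c) auto

text \<open>A finite set closed under \<open>next_control\<close> up to the empty stack: a loop body
  always returns to the same stack. This bounds the control alphabet of the cells.\<close>

fun residuals :: "cmd \<Rightarrow> cmd list set" where
  "residuals (Inc r) = {[Inc r]}"
| "residuals (Dec r) = {[Dec r]}"
| "residuals (Seq a b) = insert [Seq a b] ((\<lambda>k. k @ [b]) ` residuals a \<union> residuals b)"
| "residuals (Loop r c) = insert [Loop r c] ((\<lambda>k. k @ [Loop r c]) ` residuals c)"

lemma finite_residuals: "finite (residuals c)"
  by (induction c) auto

lemma residuals_self: "[c] \<in> residuals c"
  by (cases c) auto

lemma next_control_append: "k \<noteq> [] \<Longrightarrow> next_control (k @ l) nz = next_control k nz @ l"
  by (induction k nz rule: next_control.induct) auto

lemma residuals_nonempty: "k \<in> residuals c \<Longrightarrow> k \<noteq> []"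
  by (induction c arbitrary: k) auto

lemma residuals_next:
  "k \<in> residuals c \<Longrightarrow> next_control k nz = [] \<or> next_control k nz \<in> residuals c"
proof (induction c arbitrary: k)
  case (Seq a b)
  from Seq.prems consider "k = [Seq a b]" | l where "k = l @ [b]" "l \<in> residuals a" | "k \<in> residuals b"
    by auto
  then show ?case
  proof cases
    case 1
    then have "next_control k nz = [a] @ [b]" by simp
    then show ?thesis using residuals_self[of a] by (auto simp del: append.simps)
  next
    case 2
    then have "next_control k nz = next_control l nz @ [b]"
      using next_control_append residuals_nonempty by blast
    then show ?thesis using Seq.IH(1)[OF 2(2)] residuals_self[of b] by auto
  next
    case 3
    then show ?thesis using Seq.IH(2) by auto
  qed
next
  case (Loop r c)
  from Loop.prems consider "k = [Loop r c]" | l where "k = l @ [Loop r c]" "l \<in> residuals c"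
    by auto
  then show ?case
  proof cases
    case 1
    then have "next_control k nz = [c] @ [Loop r c] \<or> next_control k nz = []" by simp
    then show ?thesis using residuals_self[of c] by (auto simp del: append.simps)
  next
    case 2
    then have "next_control k nz = next_control l nz @ [Loop r c]"
      using next_control_append residuals_nonempty by blast
    then show ?thesis using Loop.IH[OF 2(2)] by auto
  qed
qed auto

lemma residuals_regs: "k \<in> residuals c \<Longrightarrow> x \<in> set k \<Longrightarrow> regs x \<subseteq> regs c"
  by (induction c arbitrary: k x) (auto, blast+)

section \<open>Cell constraints expressing the run of a fixed program\<close>

locale program =
  fixes c :: cmd and \<rho> :: nat and pcs :: "cmd list list"
  assumes regs: "\<And>r. r \<in> regs c \<Longrightarrow> r \<le> \<rho>" and rho: "1 \<le> \<rho>"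
    and pcs: "set pcs = insert [] (residuals c)"
begin

text \<open>Bit 0 is for register 0, bit 1 flags the second row, bit 2 marks row starts; then come
  registers 1 to \<open>\<rho>\<close> and the control stacks. Bits 0 and 1 do not move with the
  program, so the input formulas can read them at offsets 7 and 9.\<close>

definition m :: nat where "m = 3 + \<rho> + length pcs"

text \<open>Register contents are written in unary along a row: \<open>T r\<close> marks the columns
  below the value of register \<open>r\<close>.\<close>

definition T :: "nat \<Rightarrow> bool list \<Rightarrow> bool" where
  "T r x = x ! (if r = 0 then 0 else 2 + r)"

definition R :: "bool list \<Rightarrow> bool" where "R x = x ! 2"

text \<open>A cell may mark several stacks. Marks are only ever propagated or checked by
  implications, so it suffices that the true control is among them.\<close>

definition ctrl :: "bool list \<Rightarrow> cmd list \<Rightarrow> bool" where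
  "ctrl x k = (\<exists>i<length pcs. pcs ! i = k \<and> x ! (3 + \<rho> + i))"

definition Q1 :: "bool list \<Rightarrow> bool" where "Q1 x = (R x \<and> ctrl x [c])"

text \<open>For the first row: registers other than 0 are empty, and the next row start is the
  flagged cell. \<open>V\<close> copies the row marks to all later rows.\<close>

definition Q2 :: "bool list \<Rightarrow> bool list \<Rightarrow> bool" where
  "Q2 x x' = ((\<forall>r\<in>{1..\<rho>}. \<not> T r x) \<and> R x' = x' ! 1)"

text \<open>The last column of a row is empty, so no increment runs off the row; control is carried
  along the row; a halted row has register 1 empty.\<close>

definition Q3 :: "bool list \<Rightarrow> bool list \<Rightarrow> bool" where
  "Q3 x x' = ((R x' \<longrightarrow> (\<forall>r\<le>\<rho>. \<not> T r x)) \<and> (\<not> R x' \<longrightarrow> (\<forall>k\<in>set pcs. ctrl x k \<longrightarrow> ctrl x' k)) \<and>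
     (R x \<and> ctrl x [] \<longrightarrow> \<not> T 1 x))"

text \<open>\<open>Inc\<close> shifts the unary marks one column right and fills column 0,
  \<open>Dec\<close> shifts them left. The tests of \<open>R\<close> stop the shift at the row end,
  where \<open>Q3\<close> supplies the missing value.\<close>

fun rule :: "cmd list \<Rightarrow> nat \<Rightarrow> bool list \<Rightarrow> bool list \<Rightarrow> bool list \<Rightarrow> bool list \<Rightarrow> bool" where
  "rule (Inc r' # cs) r y y' z z' =
     (if r = r' then (R y \<longrightarrow> T r y) \<and> (\<not> R y' \<longrightarrow> T r y' = T r z) else T r y = T r z)"
| "rule (Dec r' # cs) r y y' z z' =
     (if r = r' then \<not> R z' \<longrightarrow> T r y = T r z' else T r y = T r z)"
| "rule cs r y y' z z' = (T r y = T r z)"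

text \<open>Control passes on in column 0, where the mark of a register says whether its value is
  positive.\<close>

definition V :: "bool list \<Rightarrow> bool list \<Rightarrow> bool list \<Rightarrow> bool list \<Rightarrow> bool" where
  "V y y' z z' = (R y = R z \<and> (R z \<longrightarrow> (\<forall>k\<in>set pcs. ctrl z k \<longrightarrow> ctrl y (next_control k (\<lambda>r. T r z)))) \<and>
     (\<forall>k\<in>set pcs. ctrl z k \<longrightarrow> (\<forall>r\<le>\<rho>. rule k r y y' z z')))"

sublocale layout m Q1 Q2 Q3 V
  by unfold_locales (simp add: m_def)

definition conf :: "nat \<Rightarrow> nat \<Rightarrow> cmd list \<times> (nat \<Rightarrow> nat)" where
  "conf n i = (step ^^ i) ([c], (\<lambda>_. 0)(0 := n))"

text \<open>Shaped for nested untils. \<open>L\<close> may be any flagged cell, since a later one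
  only constrains more columns.\<close>

definition starts_with :: "nat \<Rightarrow> (nat \<Rightarrow> bool list) \<Rightarrow> bool" where
  "starts_with n G = ((\<forall>k<n. G k ! 0) \<and> (\<exists>L\<ge>n. G L ! 1 \<and> (\<forall>k. n \<le> k \<and> k < L \<longrightarrow> \<not> G k ! 0)))"

lemma conf_Suc: "conf n (Suc i) =
    (next_control (fst (conf n i)) (\<lambda>r. 0 < snd (conf n i) r), update (fst (conf n i)) (snd (conf n i)))"
  using step_eq[of "fst (conf n i)" "snd (conf n i)"] by (simp add: conf_def)

lemma fst_conf: "fst (conf n i) \<in> set pcs"
proof (induction i)
  case 0
  show ?case by (simp add: conf_def pcs residuals_self)
next
  case (Suc i)
  then show ?case using residuals_next by (auto simp: conf_Suc pcs)
qed

lemma control_regs: "k \<in> set pcs \<Longrightarrow> x \<in> set k \<Longrightarrow> r \<in> regs x \<Longrightarrow> r \<le> \<rho>"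
  using residuals_regs[of k c x] regs by (auto simp: pcs)

lemma next_control_cong:
  assumes "k \<in> set pcs" "\<And>r. r \<le> \<rho> \<Longrightarrow> nz r = nz' r"
  shows "next_control k nz = next_control k nz'"
proof -
  have "r \<le> \<rho>" if "k = Loop r b # cs" for r b cs
    using control_regs[OF assms(1), of "Loop r b" r] that by simp
  then show ?thesis using assms(2) by (cases "(k, nz)" rule: next_control.cases) auto
qed

text \<open>By induction on \<open>i\<close>, row \<open>i\<close> of \<open>G\<close> displays
  configuration \<open>i\<close>; the row of the halted configuration then has register 1
  empty.\<close>

lemma tableau_sound:
  assumes G: "fhoriz G" and V: "\<And>L k. G L ! 1 \<Longrightarrow> V (G (L + k)) (G (Suc (L + k))) (G k) (G (Suc k))"
    and n: "starts_with n G" and N: "conf n N = ([], s)"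
  shows "s 1 = 0"
proof -
  \<comment> \<open>The row length is the first flag, possibly smaller than the witness from
    \<open>fhoriz\<close>; \<open>Q2\<close> then still covers the whole first row.\<close>
  define L where "L = (LEAST k. G k ! 1)"
  obtain L' where L': "G L' ! 1" "\<And>k. k < L' \<Longrightarrow> Q2 (G k) (G (Suc k))"
    using G by (auto simp: fhoriz_def)
  have L: "G L ! 1" unfolding L_def using L'(1) by (rule LeastI)
  have Lmin: "\<not> G k ! 1" if "k < L" for k using that not_less_Least unfolding L_def by blast
  have L3: "3 \<le> L" using G L by (meson fhoriz_def not_le)
  have LL': "L \<le> L'" using Lmin L'(1) not_le by blast
  have Q3: "Q3 (G k) (G (Suc k))" for k using G by (simp add: fhoriz_def)
  have VL: "V (G (Suc i * L + j)) (G (Suc (Suc i * L + j))) (G (i * L + j)) (G (Suc (i * L + j)))" for i j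
    using V[OF L, of "i * L + j"] by (simp add: add.assoc)
  have Rr: "R (G (i * L + j)) = (j = 0)" if "j < L" for i j
  proof (induction i)
    case 0
    show ?case
    proof (cases j)
      case 0
      then show ?thesis using G by (simp add: fhoriz_def Q1_def)
    next
      case (Suc j')
      then have "Q2 (G j') (G j)" using L'(2)[of j'] LL' that by simp
      then show ?thesis using Lmin[OF that] Suc by (simp add: Q2_def)
    qed
  next
    case (Suc i)
    then show ?case using VL[of i j] by (simp add: V_def)
  qed
  have last: "R (G (Suc (i * L + (L - 1))))" for i
    using Rr[of 0 "Suc i"] L3 by (simp add: add.commute)
  have Rn: "R (G (Suc (i * L + j))) = (Suc j = L)" if "j < L" for i j
    using last[of i] Rr[of "Suc j" i] that by (cases "Suc j = L") auto
  have carry: "ctrl (G (i * L + j)) k" if "k \<in> set pcs" "ctrl (G (i * L)) k" "j < L" for i j k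
    using that(3)
  proof (induction j)
    case (Suc j)
    then show ?case using Q3[of "i * L + j"] Rn[of j i] that(1) by (auto simp: Q3_def)
  qed (simp add: that)
  have row: "ctrl (G (i * L)) (fst (conf n i)) \<and> (\<forall>j<L. \<forall>r\<le>\<rho>. T r (G (i * L + j)) = (j < snd (conf n i) r))" for i
  proof (induction i)
    case 0
    obtain L'' where n1: "\<And>k. k < n \<Longrightarrow> G k ! 0" "G L'' ! 1" "\<And>k. n \<le> k \<Longrightarrow> k < L'' \<Longrightarrow> \<not> G k ! 0"
      using n unfolding starts_with_def by auto
    have "L \<le> L''" using Lmin n1(2) not_le by blast
    then have "T 0 (G j) = (j < n)" if "j < L" for j
      using n1(1)[of j] n1(3)[of j] that by (cases "n \<le> j") (simp_all add: T_def)
    moreover have "\<not> T r (G j)" if "j < L" "0 < r" "r \<le> \<rho>" for j r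
      using L'(2)[of j] LL' that by (auto simp: Q2_def)
    ultimately show ?case using G by (auto simp: conf_def fhoriz_def Q1_def)
  next
    case (Suc i)
    let ?k = "fst (conf n i)" and ?s = "snd (conf n i)"
    have k: "?k \<in> set pcs" by (rule fst_conf)
    have c: "ctrl (G (i * L + j)) ?k" if "j < L" for j using carry[OF k _ that] Suc by blast
    have Tz: "T r (G (i * L + j)) = (j < ?s r)" if "j < L" "r \<le> \<rho>" for j r using Suc that by blast
    have "next_control ?k (\<lambda>r. T r (G (i * L))) = next_control ?k (\<lambda>r. 0 < ?s r)"
      using Tz[of 0] L3 by (intro next_control_cong[OF k]) auto
    then have "ctrl (G (Suc i * L)) (fst (conf n (Suc i)))"
      using VL[of i 0] c[of 0] k Rr[of 0 i] L3 by (auto simp: V_def conf_Suc)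
    moreover have "T r (G (Suc i * L + j)) = (j < update ?k ?s r)" if j: "j < L" and r: "r \<le> \<rho>" for j r
    proof -
      have rl: "rule ?k r (G (Suc i * L + l)) (G (Suc (Suc i * L + l))) (G (i * L + l)) (G (Suc (i * L + l)))"
        if "l < L" for l
        using VL[of i l] c[OF that] k r by (auto simp: V_def)
      \<comment> \<open>This and \<open>T0\<close> settle the last column after a
        \<open>Dec\<close>, on which \<open>rule\<close> is silent.\<close>
      have bound: "?s r \<le> L - 1"
        using Q3[of "i * L + (L - 1)"] last[of i] Tz[of "L - 1" r] r L3 by (auto simp: Q3_def)
      have T0: "\<not> T r (G (Suc i * L + (L - 1)))"
        using Q3[of "Suc i * L + (L - 1)"] last[of "Suc i"] r by (auto simp: Q3_def)
      consider (inc) cs where "?k = Inc r # cs" | (dec) cs where "?k = Dec r # cs"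
        | (other) "T r (G (Suc i * L + j)) = T r (G (i * L + j))" "update ?k ?s r = ?s r"
        using rl[OF j] by (cases "(?k, r, G (Suc i * L + j), G (Suc (Suc i * L + j)), G (i * L + j), G (Suc (i * L + j)))"
          rule: rule.cases) (auto split: if_splits)
      then show ?thesis
      proof cases
        case inc
        show ?thesis
        proof (cases j)
          case 0
          then show ?thesis using rl[of 0] L3 inc Rr[of 0 "Suc i"] by simp
        next
          case (Suc l)
          then have "T r (G (Suc i * L + j)) = T r (G (i * L + l))"
            using rl[of l] inc j Rr[of j "Suc i"] by simp
          then show ?thesis using Tz[of l r] Suc j r inc by simp
        qed
      next
        case dec
        show ?thesis
        proof (cases "Suc j = L")
          case True
          then have "j = L - 1" by simp
          then show ?thesis using T0 bound dec by simp
        next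
          case False
          then have "T r (G (Suc i * L + j)) = T r (G (i * L + Suc j))"
            using rl[OF j] dec Rn[OF j, of i] by simp
          then show ?thesis using Tz[of "Suc j" r] False j r dec by auto
        qed
      next
        case other
        then show ?thesis using Tz[OF j r] by simp
      qed
    qed
    ultimately show ?case by (simp add: conf_Suc)
  qed
  have "R (G (N * L))" using Rr[of 0 N] L3 by simp
  moreover have "ctrl (G (N * L)) []" "T 1 (G (N * L)) = (0 < s 1)"
    using row[of N] N rho L3 by (auto dest: spec[of _ 0])
  ultimately show ?thesis using Q3[of "N * L"] by (simp add: Q3_def)
qed

definition mkcell :: "cmd list \<times> (nat \<Rightarrow> nat) \<Rightarrow> nat \<Rightarrow> bool \<Rightarrow> bool list" where
  "mkcell ks j f = [j < snd ks 0, f, j = 0] @ map (\<lambda>r. j < snd ks (Suc r)) [0..<\<rho>] @ map (\<lambda>k. k = fst ks) pcs"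

lemma mkcell_simps:
  "length (mkcell ks j f) = m" "mkcell ks j f ! 0 = (j < snd ks 0)" "mkcell ks j f ! 1 = f"
  "R (mkcell ks j f) = (j = 0)" "r \<le> \<rho> \<Longrightarrow> T r (mkcell ks j f) = (j < snd ks r)"
  "ctrl (mkcell ks j f) k = (k = fst ks \<and> k \<in> set pcs)"
proof -
  show "length (mkcell ks j f) = m" by (simp add: mkcell_def m_def)
  show "mkcell ks j f ! 0 = (j < snd ks 0)" "mkcell ks j f ! 1 = f" "R (mkcell ks j f) = (j = 0)"
    by (simp_all add: mkcell_def R_def)
  show "r \<le> \<rho> \<Longrightarrow> T r (mkcell ks j f) = (j < snd ks r)"
    by (cases r) (auto simp: T_def mkcell_def nth_append)
  have "mkcell ks j f ! (3 + \<rho> + i) = (pcs ! i = fst ks)" if "i < length pcs" for i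
    using that by (simp add: mkcell_def nth_append)
  then show "ctrl (mkcell ks j f) k = (k = fst ks \<and> k \<in> set pcs)"
    unfolding ctrl_def in_set_conv_nth by auto
qed

text \<open>A halted configuration repeats forever, so register values are bounded, one row length
  suffices, and the rows are eventually constant.\<close>

lemma tableau_complete:
  assumes N: "conf n N = ([], s)" and s: "s 1 = 0"
  obtains G p q where "\<And>k. length (G k) = m" "fhoriz G" "starts_with n G"
    "\<And>L k. G L ! 1 \<Longrightarrow> V (G (L + k)) (G (Suc (L + k))) (G k) (G (Suc k))"
    "0 < q" "\<And>k. p \<le> k \<Longrightarrow> G (k + q) = G k"
proof -
  have stop: "conf n (N + i) = ([], s)" for i
  proof (induction i)
    case (Suc i)
    then show ?case using conf_Suc[of n "N + i"] by simp
  qed (simp add: N)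
  have stop: "conf n i = ([], s)" if "N \<le> i" for i
    using stop[of "i - N"] that by simp
  \<comment> \<open>The surplus over the largest register value keeps the last column empty and the
    row long enough for \<open>fhoriz\<close>.\<close>
  define L where "L = 4 + Max ((\<lambda>(i, r). snd (conf n i) r) ` ({..N} \<times> {..\<rho>}))"
  have bound': "snd (conf n i) r \<le> L - 4" if "i \<le> N" "r \<le> \<rho>" for i r
    unfolding L_def using that by (auto intro!: Max_ge image_eqI[of _ _ "(i, r)"])
  have bound: "snd (conf n i) r < L - 1" if "r \<le> \<rho>" for i r
  proof -
    have "conf n i = conf n (min i N)" using stop[of i] N by (cases "i \<le> N") auto
    then have "snd (conf n i) r \<le> L - 4" using bound'[of "min i N" r] that by simp
    then show ?thesis by (simp add: L_def)
  qed
  have L: "4 \<le> L" by (simp add: L_def)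
  \<comment> \<open>Only cell \<open>L\<close> is flagged, as every flagged position must be a
    correct row shift for \<open>V\<close>.\<close>
  define G where "G k = mkcell (conf n (k div L)) (k mod L) (k = L)" for k
  have Gc: "G (i * L + j) = mkcell (conf n i) j (i * L + j = L)" if "j < L" for i j
    using that L by (simp add: G_def)
  have row: "\<exists>i j. k = i * L + j \<and> j < L" for k
    using L by (intro exI[of _ "k div L"] exI[of _ "k mod L"]) auto
  have Gs: "G (Suc (i * L + j)) = (if Suc j < L then mkcell (conf n i) (Suc j) (i * L + Suc j = L)
      else mkcell (conf n (Suc i)) 0 (Suc i * L = L))" if "j < L" for i j
  proof (cases "Suc j < L")
    case True
    then show ?thesis using Gc[of "Suc j" i] by simp
  next
    case False
    then have "Suc (i * L + j) = Suc i * L + 0" using that by simp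
    then show ?thesis using Gc[of 0 "Suc i"] L False by (simp only:) simp
  qed
  have G1: "G k ! 1 = (k = L)" for k unfolding G_def by (rule mkcell_simps)
  have pc: "fst (conf n i) \<in> set pcs" for i by (rule fst_conf)
  have Q3: "Q3 (G k) (G (Suc k))" for k
  proof -
    obtain i j where k: "k = i * L + j" "j < L" using row by blast
    have "snd (conf n i) 1 = 0" if "fst (conf n i) = []"
    proof (cases "N \<le> i")
      case True
      then show ?thesis using stop s by simp
    next
      case False
      have "conf n (i + l) = conf n i" for l
      proof (induction l)
        case (Suc l)
        then show ?case using conf_Suc[of n "i + l"] that by (simp add: prod_eq_iff)
      qed simp
      from this[of "N - i"] have "conf n i = ([], s)" using False N by simp
      then show ?thesis using s by simp
    qed
    then have end1: "fst (conf n i) = [] \<Longrightarrow> \<not> T 1 (mkcell (conf n i) j f)" for f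
      using rho by (simp add: mkcell_simps)
    show ?thesis
    proof (cases "Suc j < L")
      case True
      then show ?thesis using end1 unfolding k(1) Gs[OF k(2)] Gc[OF k(2)] by (auto simp: Q3_def mkcell_simps)
    next
      case False
      then have "\<not> j < snd (conf n i) r" if "r \<le> \<rho>" for r using bound[OF that, of i] by simp
      then show ?thesis using False end1 unfolding k(1) Gs[OF k(2)] Gc[OF k(2)] by (auto simp: Q3_def mkcell_simps)
    qed
  qed
  have V: "V (G (L + k)) (G (Suc (L + k))) (G k) (G (Suc k))" for k
  proof -
    obtain i j where k: "k = i * L + j" "j < L" using row by blast
    let ?k = "fst (conf n i)" and ?s = "snd (conf n i)"
    have Lk: "L + k = Suc i * L + j" by (simp add: k)
    have u: "snd (conf n (Suc i)) = update ?k ?s" by (simp add: conf_Suc)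
    have nc: "next_control ?k (\<lambda>r. T r (mkcell (conf n i) j f)) = fst (conf n (Suc i))" if "j = 0" for f
      unfolding conf_Suc fst_conv using that by (intro next_control_cong[OF pc]) (simp add: mkcell_simps)
    have "rule ?k r (G (L + k)) (G (Suc (L + k))) (G k) (G (Suc k))" if r: "r \<le> \<rho>" for r
    proof -
      have b: "?s r < L - 1" "snd (conf n (Suc i)) r < L - 1" using bound[OF r] by auto
      have z: "T r (G k) = (j < ?s r)" "Suc j < L \<Longrightarrow> T r (G (Suc k)) = (Suc j < ?s r)"
        "R (G (Suc k)) = (\<not> Suc j < L)"
        unfolding k(1) Gs[OF k(2)] Gc[OF k(2)] using r by (simp_all add: mkcell_simps)
      have y: "T r (G (L + k)) = (j < update ?k ?s r)" "R (G (L + k)) = (j = 0)"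
        "Suc j < L \<Longrightarrow> T r (G (Suc (L + k))) = (Suc j < update ?k ?s r)"
        "R (G (Suc (L + k))) = (\<not> Suc j < L)"
        unfolding Lk Gs[OF k(2)] Gc[OF k(2)] using r by (simp_all add: mkcell_simps u)
      show ?thesis
        by (cases "(?k, r, G (L + k), G (Suc (L + k)), G k, G (Suc k))" rule: rule.cases)
          (auto simp: z y)
    qed
    moreover have "R (G (L + k)) = R (G k)" "R (G k) = (j = 0)"
      unfolding Lk unfolding k(1) Gc[OF k(2)] by (simp_all add: mkcell_simps)
    moreover have "ctrl (G k) k' \<longleftrightarrow> k' = ?k" "ctrl (G (L + k)) k' \<longleftrightarrow> k' = fst (conf n (Suc i))" for k'
      unfolding Lk unfolding k(1) Gc[OF k(2)] using pc by (auto simp: mkcell_simps)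
    moreover have "j = 0 \<Longrightarrow> next_control ?k (\<lambda>r. T r (G k)) = fst (conf n (Suc i))"
      unfolding k(1) Gc[OF k(2)] by (rule nc)
    ultimately show ?thesis by (auto simp: V_def)
  qed
  have c0: "conf n 0 = ([c], (\<lambda>_. 0)(0 := n))" by (simp add: conf_def)
  have G0: "G k = mkcell (conf n 0) k False" if "k < L" for k using Gc[of k 0] that by simp
  have Q2: "Q2 (G k) (G (Suc k))" if "k < L" for k
    unfolding Q2_def G1 G0[OF that] using Gs[of k 0] that by (auto simp: mkcell_simps c0)
  have hz: "fhoriz G"
    unfolding fhoriz_def G1
    using Q3 L G0[of 0] residuals_self[of c] by (auto simp: Q1_def mkcell_simps c0 pcs intro!: exI[of _ L] Q2)
  have "n < L - 1" using bound[of 0 0] by (simp add: c0)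
  then have sw: "starts_with n G"
    unfolding starts_with_def G1 using L by (auto simp: G0 mkcell_simps c0 intro!: exI[of _ L])
  \<comment> \<open>The period begins after halting and beyond row 1, whose flag does not
    recur.\<close>
  have per: "G (k + L) = G k" if "(N + 2) * L \<le> k" for k
  proof -
    obtain i j where k: "k = i * L + j" "j < L" using row by blast
    have "(N + 2) * L < (i + 1) * L" using that k by simp
    then have i: "N \<le> i" "2 \<le> i" using L by (simp_all del: mult_Suc)
    have kL: "k + L = Suc i * L + j" by (simp add: k)
    have "i * L + j \<noteq> L" "Suc i * L + j \<noteq> L"
      using L mult_le_mono1[OF i(2), of L] unfolding mult_Suc by linarith+
    then have f: "(i * L + j = L) = False" "(Suc i * L + j = L) = False" by blast+
    show ?thesis unfolding kL unfolding k(1) Gc[OF k(2)] f using stop i(1) by simp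
  qed
  show ?thesis
  proof (rule that)
    show "length (G k) = m" for k by (simp add: G_def mkcell_simps)
    show "V (G (L' + k)) (G (Suc (L' + k))) (G k) (G (Suc k))" if "G L' ! 1" for L' k
      using that V unfolding G1 by simp
    show "0 < L" using L by simp
  qed (use hz sw per in auto)
qed

end

section \<open>Undecidability\<close>

definition header_ltl :: "s0var ltl" where
  "header_ltl = LAnd (LProp VarY) (LNext (LProp VarY))"

text \<open>The formula reaches the next cell by searching for the next header instead of counting to the
  frame width: the width depends on the program, and the program has to compute the code of this
  formula.\<close>

fun unary_ltl :: "nat \<Rightarrow> s0var ltl" where
  "unary_ltl 0 = LUntil (LNot (LAnd header_ltl ((LNext ^^ 7) (LProp VarY))))
     (LAnd header_ltl ((LNext ^^ 9) (LProp VarY)))"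
| "unary_ltl (Suc n) = LAnd ((LNext ^^ 7) (LProp VarY))
     (LNext (LUntil (LNot header_ltl) (LAnd header_ltl (unary_ltl n))))"

definition input_ltl :: "nat \<Rightarrow> s0var ltl" where
  "input_ltl n = LNot (LAnd ((LNext ^^ 3) (LProp VarX)) (LNot (unary_ltl n)))"

lemma ltl_holds_nexts: "ltl_holds u i ((LNext ^^ n) \<phi>) = ltl_holds u (i + n) \<phi>"
  by (induction n arbitrary: i) simp_all

lemma rcomp1_pair_const: "rcomp1 f \<Longrightarrow> rcomp1 (\<lambda>n. prod_encode (a, f n))"
  by (rule rcomp1_comp2[OF rcomp2_prod_encode rcomp1_const])

lemma rcomp1_enc_unary: "rcomp1 (\<lambda>n. enc_ltl (unary_ltl n))"
proof -
  let ?a = "enc_ltl ((LNext ^^ 7) (LProp VarY))" and ?h = "enc_ltl header_ltl"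
    and ?b = "enc_ltl (LNot header_ltl)"
  let ?g = "\<lambda>v. prod_encode (2, prod_encode (?a, prod_encode (3, prod_encode (4,
    prod_encode (?b, prod_encode (2, prod_encode (?h, v)))))))"
  have "rcomp1 ?g" by (intro rcomp1_pair_const rcomp1_id)
  then have "rcomp1 (rec_nat (enc_ltl (unary_ltl 0)) (\<lambda>_ v. ?g v))"
    by (intro rcomp1_rec_nat rcomp2_comp1[OF _ rcomp2_snd])
  moreover have "rec_nat (enc_ltl (unary_ltl 0)) (\<lambda>_ v. ?g v) = (\<lambda>n. enc_ltl (unary_ltl n))"
  proof
    show "rec_nat (enc_ltl (unary_ltl 0)) (\<lambda>_ v. ?g v) n = enc_ltl (unary_ltl n)" for n
      by (induction n) simp_all
  qed
  ultimately show ?thesis by simp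
qed

lemma rcomp1_enc_input: "rcomp1 (\<lambda>n. enc_ltl (input_ltl n))"
  unfolding input_ltl_def enc_ltl.simps
  by (intro rcomp1_pair_const rcomp1_enc_unary)

context program
begin

lemma header_holds: "ltl_holds u i header_ltl = H (tracks u VarY) i"
  by (simp add: header_ltl_def H_def tracks_def)

lemma unary_holds:
  assumes c: "clock (tracks u VarY) 0"
  shows "ltl_holds u (w * t) (unary_ltl n) \<longleftrightarrow> starts_with n (\<lambda>k. cel (tracks u VarY) (t + k))"
proof (induction n arbitrary: t)
  let ?y = "tracks u VarY"
  have y0: "ltl_holds u i ((LNext ^^ n) (LProp VarY)) = ?y (i + n)" for i n
    by (simp add: ltl_holds_nexts tracks_def)
  have bit0: "?y (w * t + 7) = cel ?y t ! 0" for t using m2 by (simp add: nth_cel)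
  {
    case 0
    have "ltl_holds u (w * t) (unary_ltl 0) \<longleftrightarrow>
      (\<exists>j\<ge>w * t. (H ?y j \<and> ?y (j + 9)) \<and> (\<forall>k. w * t \<le> k \<and> k < j \<longrightarrow> H ?y k \<longrightarrow> \<not> ?y (k + 7)))"
      by (simp only: unary_ltl.simps ltl_holds.simps header_holds y0 imp_conv_disj de_Morgan_conj)
    also have "\<dots> \<longleftrightarrow> (\<exists>L\<ge>t. cel ?y L ! 1 \<and> (\<forall>k. t \<le> k \<and> k < L \<longrightarrow> \<not> cel ?y k ! 0))"
      unfolding frames_from[OF c] w_le_iff w_less_iff cel_flag bit0 ..
    also have "\<dots> \<longleftrightarrow> starts_with 0 (\<lambda>k. cel ?y (t + k))"
    proof
      assume "\<exists>L\<ge>t. cel ?y L ! 1 \<and> (\<forall>k. t \<le> k \<and> k < L \<longrightarrow> \<not> cel ?y k ! 0)"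
      then obtain L where "t \<le> L" "cel ?y L ! 1" "\<forall>k. t \<le> k \<and> k < L \<longrightarrow> \<not> cel ?y k ! 0" by blast
      then show "starts_with 0 (\<lambda>k. cel ?y (t + k))"
        unfolding starts_with_def by (intro conjI exI[of _ "L - t"]) auto
    next
      assume "starts_with 0 (\<lambda>k. cel ?y (t + k))"
      then obtain L where L: "cel ?y (t + L) ! 1" "\<forall>k<L. \<not> cel ?y (t + k) ! 0"
        by (auto simp: starts_with_def)
      have "\<not> cel ?y k ! 0" if "t \<le> k" "k < t + L" for k
        using L(2)[rule_format, of "k - t"] that by simp
      then show "\<exists>L\<ge>t. cel ?y L ! 1 \<and> (\<forall>k. t \<le> k \<and> k < L \<longrightarrow> \<not> cel ?y k ! 0)"
        using L(1) by (intro exI[of _ "t + L"]) auto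
    qed
    finally show ?case .
  next
    case (Suc n)
    let ?P = "\<lambda>j. ltl_holds u j (unary_ltl n)"
    have "ltl_holds u (w * t) (unary_ltl (Suc n)) \<longleftrightarrow> cel ?y t ! 0 \<and>
      (\<exists>j\<ge>Suc (w * t). (H ?y j \<and> ?P j) \<and> (\<forall>k. Suc (w * t) \<le> k \<and> k < j \<longrightarrow> H ?y k \<longrightarrow> False))"
      by (simp only: unary_ltl.simps ltl_holds.simps header_holds y0 bit0 simp_thms)
    also have "\<dots> \<longleftrightarrow> cel ?y t ! 0 \<and> (\<exists>e>t. ?P (w * e) \<and> (\<forall>k. t < k \<and> k < e \<longrightarrow> False))"
      unfolding frames_from[OF c] unfolding Suc_le_eq w_less_iff ..
    also have "(\<exists>e>t. ?P (w * e) \<and> (\<forall>k. t < k \<and> k < e \<longrightarrow> False)) \<longleftrightarrow> ?P (w * Suc t)"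
    proof
      assume "\<exists>e>t. ?P (w * e) \<and> (\<forall>k. t < k \<and> k < e \<longrightarrow> False)"
      then obtain e where e: "t < e" "?P (w * e)" "\<not> Suc t < e" by blast
      then have "e = Suc t" by simp
      then show "?P (w * Suc t)" using e(2) by (simp only:)
    next
      assume "?P (w * Suc t)"
      then show "\<exists>e>t. ?P (w * e) \<and> (\<forall>k. t < k \<and> k < e \<longrightarrow> False)"
        by (intro exI[of _ "Suc t"]) auto
    qed
    also have "?P (w * Suc t) \<longleftrightarrow> starts_with n (\<lambda>k. cel ?y (Suc t + k))"
      by (rule Suc)
    also have "cel ?y t ! 0 \<and> starts_with n (\<lambda>k. cel ?y (Suc t + k)) \<longleftrightarrow>
      starts_with (Suc n) (\<lambda>k. cel ?y (t + k))"
    proof -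
      have ex: "(\<exists>L\<ge>Suc n. P L) = (\<exists>L\<ge>n. P (Suc L))" for P
        by (metis Suc_le_D Suc_le_mono)
      have all: "(\<forall>k. Suc n \<le> k \<and> k < Suc L \<longrightarrow> P k) = (\<forall>k. n \<le> k \<and> k < L \<longrightarrow> P (Suc k))" for P L
        by (metis Suc_le_D Suc_le_mono Suc_less_eq)
      have "(\<forall>k<Suc n. P k) = (P 0 \<and> (\<forall>k<n. P (Suc k)))" for P
        by (metis less_Suc_eq_0_disj)
      then show ?thesis unfolding starts_with_def ex all by simp
    qed
    finally show ?case .
  }
qed

text \<open>Since the program halts, an accepting tableau is eventually periodic and a finite
  machine can play it; conversely every realization plays a tableau.\<close>

lemma realizable_iff:
  assumes B: "\<And>w i. ltl_holds w i B = body (tracks w VarX) (tracks w VarY) (tracks w VarZ) i"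
    and N: "conf n N = ([], s)"
  shows "S0_realizable (LAnd (input_ltl n) B) \<longleftrightarrow> s 1 = 0"
proof -
  let ?P = "\<lambda>x y z. fbody x y z \<and> (kap x 0 \<longrightarrow> starts_with n (cel y))"
  have hold: "ltl_holds u 0 (LAnd (input_ltl n) B) \<longleftrightarrow> ?P (tracks u VarX) (tracks u VarY) (tracks u VarZ)" for u
  proof (cases "clock (tracks u VarY) 0")
    case True
    have "ltl_holds u 0 (unary_ltl n) = starts_with n (cel (tracks u VarY))"
      using unary_holds[OF True, of 0 n] by simp
    then show ?thesis
      unfolding ltl_holds.simps B body_frames
      by (auto simp: input_ltl_def ltl_holds_nexts kap_def tracks_def)
  next
    case False
    then show ?thesis by (simp add: B body_frames fbody_def)
  qed
  have sys: "sys_satisfies S0 M (LAnd (input_ltl n) B) \<longleftrightarrow>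
    (\<forall>x. ?P x (transd M x) (transd M (transd M x)))" for M :: "(nat, inp, outp) moore"
    by (rule sys_satisfies_S0_0) (rule hold)
  show ?thesis
  proof
    assume "S0_realizable (LAnd (input_ltl n) B)"
    then obtain M :: "(nat, inp, outp) moore" where
      M: "\<And>x. ?P x (transd M x) (transd M (transd M x))"
      unfolding S0_realizable_def sys by blast
    interpret correct m Q1 Q2 Q3 V "transd M"
      by unfold_locales (use M transd_causal in blast)+
    obtain x where x: "kap x 0" "fhoriz (cel (transd M x))"
      "\<And>L k. cel (transd M x) L ! 1 \<Longrightarrow> V (cel (transd M x) (L + k)) (cel (transd M x) (Suc (L + k)))
        (cel (transd M x) k) (cel (transd M x) (Suc k))"
      by (rule sound) blast
    show "s 1 = 0"
      by (rule tableau_sound[OF x(2,3) _ N]) (use M x(1) in blast)+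
  next
    assume s: "s 1 = 0"
    obtain G p q where G: "\<And>k. length (G k) = m" "fhoriz G" "starts_with n G"
      "\<And>L k. G L ! 1 \<Longrightarrow> V (G (L + k)) (G (Suc (L + k))) (G k) (G (Suc k))"
      "0 < q" "\<And>k. p \<le> k \<Longrightarrow> G (k + q) = G k"
      by (rule tableau_complete[OF N s]) blast
    obtain M :: "(nat, inp, outp) moore" where M: "finite_moore M" "transd M = honest G"
      "\<And>x. fbody x (transd M x) (transd M (transd M x))"
      by (rule complete[OF G(1,2,4,5,6)]) blast+
    have "cel (transd M x) = G" if "kap x 0" for x
    proof
      show "cel (transd M x) t = G t" for t
        using cel_honest[OF G(1), where x = x and s = 0 and t = t] that by (simp add: M(2) pulse_def)
    qed
    then have "?P x (transd M x) (transd M (transd M x))" for x using M(3) G(3) by simp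
    then show "S0_realizable (LAnd (input_ltl n) B)"
      unfolding S0_realizable_def sys using M(1) by blast
  qed
qed

end

text \<open>\<open>B\<close> is fixed before \<open>n\<close>, so its own code may be taken for
  \<open>n\<close> afterwards.\<close>

lemma decider_body:
  assumes "\<And>n. reval F [n] (h n)"
  obtains B where "\<And>n. S0_realizable (LAnd (input_ltl n) B) \<longleftrightarrow> h n = 0"
proof -
  obtain c where c: "\<And>n. run c ((\<lambda>_. 0)(0 := n)) ((\<lambda>_. 0)(0 := n, 1 := h n))"
    using compile_unary[OF assms] by blast
  obtain pcs where pcs: "set pcs = insert [] (residuals c)"
    using finite_list finite_residuals by (metis finite_insert)
  define \<rho> where "\<rho> = Max (insert 1 (regs c))"
  interpret program c \<rho> pcs
    by unfold_locales (auto simp: \<rho>_def pcs finite_regs intro: Max_ge)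
  obtain B where B: "\<And>w i. ltl_holds w i B = body (tracks w VarX) (tracks w VarY) (tracks w VarZ) i"
    using definable_body unfolding definable_def by blast
  have "S0_realizable (LAnd (input_ltl n) B) \<longleftrightarrow> h n = 0" for n
  proof -
    obtain N where "(step ^^ N) ([c], (\<lambda>_. 0)(0 := n)) = ([], (\<lambda>_. 0)(0 := n, 1 := h n))"
      using c[of n] unfolding run_def by blast
    then have "conf n N = ([], (\<lambda>_. 0)(0 := n, 1 := h n))" by (simp add: conf_def)
    from realizable_iff[OF B this] show ?thesis by simp
  qed
  then show ?thesis by (rule that)
qed

theorem theorem14:
  shows "\<not> decidable_ltl_prop S0_realizable"
proof
  assume "decidable_ltl_prop S0_realizable"
  then obtain f where "\<forall>n. \<exists>r. reval f [n] r \<and> (\<forall>\<phi>. n = enc_ltl \<phi> \<longrightarrow> r = (if S0_realizable \<phi> then 1 else 0))"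
    unfolding decidable_ltl_prop_def by blast
  \<comment> \<open>The decider also answers on numbers that are no codes, so its answers form a
    total function, as the compilation requires.\<close>
  then have "\<exists>d. \<forall>n. reval f [n] (d n) \<and> (\<forall>\<phi>. n = enc_ltl \<phi> \<longrightarrow> d n = (if S0_realizable \<phi> then 1 else 0))"
    by (rule choice)
  then obtain d where d: "\<And>n. reval f [n] (d n)" "\<And>\<phi>. d (enc_ltl \<phi>) = (if S0_realizable \<phi> then 1 else 0)"
    by blast
  \<comment> \<open>If \<open>n\<close> codes a formula, this codes its conjunction with
    \<open>input_ltl n\<close>, computed without decoding \<open>n\<close>.\<close>
  let ?code = "\<lambda>n. prod_encode (2, prod_encode (enc_ltl (input_ltl n), n))"
  have "rcomp1 ?code"
    by (intro rcomp1_pair_const rcomp1_comp2[OF rcomp2_prod_encode] rcomp1_enc_input rcomp1_id)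
  then obtain e where e: "\<And>n. reval e [n] (?code n)" unfolding rcomp1_def by blast
  have r: "reval (RCn f [e]) [n] (d (?code n))" for n
    by (rule reval.comp[of _ _ "[?code n]"]) (simp_all add: e d)
  obtain B where B: "\<And>n. S0_realizable (LAnd (input_ltl n) B) \<longleftrightarrow> d (?code n) = 0"
    using decider_body[OF r] by metis
  \<comment> \<open>The diagonal instance: this formula is realizable iff the decider rejects
    it.\<close>
  let ?\<phi> = "LAnd (input_ltl (enc_ltl B)) B"
  have "S0_realizable ?\<phi> \<longleftrightarrow> d (enc_ltl ?\<phi>) = 0" using B[of "enc_ltl B"] by simp
  then show False using d(2)[of ?\<phi>] by (cases "S0_realizable ?\<phi>") simp_all
qed

end
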